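(* There is an absolute constant $c>0$ and an algorithm which, given integers $n\ge k\ge 2$ and an invertible $n\times n$ $k$-diagonal cyclic banded matrix $M$ over a field $F$ (specified by its coefficients $x_s^{(r)}\in F$, $1\le s\le k$, $1\le r\le n$, with $x_k^{(r)}\neq 0$ for all $r$, and by the index of its upper-left coefficient), computes all $n^2$ entries of the inverse $M^{-1}$ using at most $c\,(k^3 n+k^5)+kn^2$ multiplications and divisions in $F$. That is, the inverse of a $k$-diagonal cyclic banded matrix can be computed with cost $O(k^3n+k^5)+kn^2$.
   Context: A $k$-diagonal cyclic banded matrix ($k$-CBM) of order $n$ over a field $F$ is given by coefficients $x_s^{(r)}\in F$ ($1\le s\le k$, $1\le r\le n$) with $x_k^{(r)}\neq 0$ for every $r$, and an index $i\in\{1,\dots,k\}$ (the upper-left entry is $x_i^{(1)}$): for each row $r$ and each $s\in\{1,\dots,k\}$, the entry in row $r$ and column $r+s-i$ (column indices read modulo $n$ in $\{1,\dots,n\}$) is $x_s^{(r)}$, and all other entries are $0$; moreover there exist $s,r,r'$ with $x_s^{(r)}\ne x_s^{(r')}$ (otherwise the matrix is called $k$-diagonal circulant). Cost is the number of multiplications and divisions in $F$. *)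

theory Defs
  imports Complex_Main "HOL-Algebra.Ring" "HOL-Number_Theory.Cong"
begin

section \<open>Loop programs over a field\<close>

text \<open>
  An algorithm is one finite program text that mentions neither the field nor the size of the
  input. It manipulates natural-number variables, which steer the control flow and the addressing,
  and two-dimensional arrays of field elements, which can only be accessed through the field
  operations and zero tests.
\<close>

datatype iexp =
  Num nat | Var string
| Plus iexp iexp | Minus iexp iexp | Times iexp iexp | Quot iexp iexp | Rem iexp iexp

primrec ival :: "iexp \<Rightarrow> (string \<Rightarrow> nat) \<Rightarrow> nat" where
  "ival (Num m) v = m"
| "ival (Var a) v = v a"
| "ival (Plus e f) v = ival e v + ival f v"
| "ival (Minus e f) v = ival e v - ival f v"
| "ival (Times e f) v = ival e v * ival f v"
| "ival (Quot e f) v = ival e v div ival f v"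
| "ival (Rem e f) v = ival e v mod ival f v"

datatype loc = Loc string iexp iexp

datatype farith = FAdd | FSub | FMul | FDiv

datatype prog =
  Skip
| Seq prog prog
| ISet string iexp
| FZero loc
| FOne loc
| FOp farith loc loc loc (* FOp f d a b stores the value of a f b in d *)
| IfZero loc prog prog
| IfLess iexp iexp prog prog
| For string iexp prog

record 'a state =
  ivar :: "string \<Rightarrow> nat"
  arr :: "string \<Rightarrow> nat \<Rightarrow> nat \<Rightarrow> 'a"
  cost :: nat

primrec fget :: "loc \<Rightarrow> 'a state \<Rightarrow> 'a" where
  "fget (Loc a e f) st = arr st a (ival e (ivar st)) (ival f (ivar st))"

primrec fput :: "loc \<Rightarrow> 'a \<Rightarrow> 'a state \<Rightarrow> 'a state" where
  "fput (Loc a e f) z st =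
     st\<lparr>arr := (\<lambda>b p q. if b = a \<and> p = ival e (ivar st) \<and> q = ival f (ivar st)
                        then z else arr st b p q)\<rparr>"

definition iput :: "string \<Rightarrow> nat \<Rightarrow> 'a state \<Rightarrow> 'a state" where
  "iput a m st = st\<lparr>ivar := (ivar st)(a := m)\<rparr>"

fun farith_val :: "'a ring \<Rightarrow> farith \<Rightarrow> 'a \<Rightarrow> 'a \<Rightarrow> 'a option" where
  "farith_val F FAdd a b = Some (a \<oplus>\<^bsub>F\<^esub> b)"
| "farith_val F FSub a b = Some (a \<ominus>\<^bsub>F\<^esub> b)"
| "farith_val F FMul a b = Some (a \<otimes>\<^bsub>F\<^esub> b)"
| "farith_val F FDiv a b = (if b = \<zero>\<^bsub>F\<^esub> then None else Some (a \<otimes>\<^bsub>F\<^esub> inv\<^bsub>F\<^esub> b))"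

fun farith_cost :: "farith \<Rightarrow> nat" where
  "farith_cost FAdd = 0"
| "farith_cost FSub = 0"
| "farith_cost FMul = 1"
| "farith_cost FDiv = 1"

text \<open>
  The result \<^const>\<open>None\<close> means that the run was aborted by a division by zero. The number of
  iterations of a \<^const>\<open>For\<close> loop is determined on entry, and its variable takes the values
  0, 1, 2, \dots.
\<close>

primrec exec :: "'a ring \<Rightarrow> prog \<Rightarrow> 'a state \<Rightarrow> 'a state option" where
  "exec F Skip st = Some st"
| "exec F (Seq p q) st = Option.bind (exec F p st) (exec F q)"
| "exec F (ISet a e) st = Some (iput a (ival e (ivar st)) st)"
| "exec F (FZero d) st = Some (fput d \<zero>\<^bsub>F\<^esub> st)"
| "exec F (FOne d) st = Some (fput d \<one>\<^bsub>F\<^esub> st)"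
| "exec F (FOp f d a b) st =
     map_option (\<lambda>z. fput d z (st\<lparr>cost := cost st + farith_cost f\<rparr>))
       (farith_val F f (fget a st) (fget b st))"
| "exec F (IfZero a p q) st = (if fget a st = \<zero>\<^bsub>F\<^esub> then exec F p st else exec F q st)"
| "exec F (IfLess e f p q) st =
     (if ival e (ivar st) < ival f (ivar st) then exec F p st else exec F q st)"
| "exec F (For a e p) st =
     fold (\<lambda>j so. Option.bind so (\<lambda>st'. exec F p (iput a j st'))) [0..<ival e (ivar st)] (Some st)"


section \<open>Matrices over a field\<close>

text \<open>
  A matrix of order \<open>n\<close> is a function of a row and a column index, of which only the values at
  indices in \<open>{1..n}\<close> matter.
\<close>

definition inverse_matrix ::
    "'a ring \<Rightarrow> nat \<Rightarrow> (nat \<Rightarrow> nat \<Rightarrow> 'a) \<Rightarrow> (nat \<Rightarrow> nat \<Rightarrow> 'a) \<Rightarrow> bool" where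
  "inverse_matrix F n M N \<longleftrightarrow>
     (\<forall>r\<in>{1..n}. \<forall>c\<in>{1..n}.
        N r c \<in> carrier F
      \<and> (\<Oplus>\<^bsub>F\<^esub>l\<in>{1..n}. M r l \<otimes>\<^bsub>F\<^esub> N l c) = (if r = c then \<one>\<^bsub>F\<^esub> else \<zero>\<^bsub>F\<^esub>)
      \<and> (\<Oplus>\<^bsub>F\<^esub>l\<in>{1..n}. N r l \<otimes>\<^bsub>F\<^esub> M l c) = (if r = c then \<one>\<^bsub>F\<^esub> else \<zero>\<^bsub>F\<^esub>))"

definition invertible_matrix :: "'a ring \<Rightarrow> nat \<Rightarrow> (nat \<Rightarrow> nat \<Rightarrow> 'a) \<Rightarrow> bool" where
  "invertible_matrix F n M \<longleftrightarrow> (\<exists>N. inverse_matrix F n M N)"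

text \<open>
  \<open>M\<close> is the \<open>k\<close>-diagonal cyclic banded matrix of order \<open>n\<close> with coefficients \<open>x s r\<close> (superscript
  \<open>r\<close>, subscript \<open>s\<close>) whose upper-left entry is \<open>x i 1\<close>. The last conjunct excludes the
  \<open>k\<close>-diagonal circulant matrices.
\<close>

definition is_cbm ::
    "'a ring \<Rightarrow> nat \<Rightarrow> nat \<Rightarrow> nat \<Rightarrow> (nat \<Rightarrow> nat \<Rightarrow> 'a) \<Rightarrow> (nat \<Rightarrow> nat \<Rightarrow> 'a) \<Rightarrow> bool" where
  "is_cbm F n k i x M \<longleftrightarrow>
     i \<in> {1..k}
   \<and> (\<forall>s\<in>{1..k}. \<forall>r\<in>{1..n}. x s r \<in> carrier F)
   \<and> (\<forall>r\<in>{1..n}. x k r \<noteq> \<zero>\<^bsub>F\<^esub>)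
   \<and> (\<forall>r\<in>{1..n}. \<forall>c\<in>{1..n}. \<forall>s\<in>{1..k}.
        [int c = int r + int s - int i] (mod int n) \<longrightarrow> M r c = x s r)
   \<and> (\<forall>r\<in>{1..n}. \<forall>c\<in>{1..n}.
        (\<forall>s\<in>{1..k}. \<not> [int c = int r + int s - int i] (mod int n)) \<longrightarrow> M r c = \<zero>\<^bsub>F\<^esub>)
   \<and> (\<exists>s\<in>{1..k}. \<exists>r\<in>{1..n}. \<exists>r'\<in>{1..n}. x s r \<noteq> x s r')"


section \<open>Inversion of cyclic banded matrices\<close>

definition cbm_input ::
    "'a ring \<Rightarrow> nat \<Rightarrow> nat \<Rightarrow> nat \<Rightarrow> (nat \<Rightarrow> nat \<Rightarrow> 'a) \<Rightarrow> 'a state" where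
  "cbm_input F n k i x =
     \<lparr>ivar = (\<lambda>_. 0)(''n'' := n, ''k'' := k, ''i'' := i),
      arr = (\<lambda>a s r. if a = ''x'' \<and> s \<in> {1..k} \<and> r \<in> {1..n} then x s r else \<zero>\<^bsub>F\<^esub>),
      cost = 0\<rparr>"

text \<open>
  The program \<open>p\<close> inverts all invertible cyclic banded matrices over all fields whose carrier is a
  set of elements of type \<open>'a\<close>, with the cost bound given by the constant \<open>C\<close>. The entries of the
  inverse are found in the array \<open>inv\<close>.

  Types cannot be quantified inside a formula, so "there are \<open>C\<close> and \<open>p\<close> that work for all fields"
  takes two steps: there are \<open>C\<close> and \<open>p\<close> that work for all fields on sets of natural numbers, and
  whatever \<open>C\<close> and \<open>p\<close> work for these also work for all fields on an arbitrary type.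
\<close>

definition inverts_cbms :: "'a itself \<Rightarrow> prog \<Rightarrow> real \<Rightarrow> bool" where
  "inverts_cbms T p C \<longleftrightarrow>
     (\<forall>(F :: 'a ring) n k i x M.
        field F \<and> 2 \<le> k \<and> k \<le> n \<and> is_cbm F n k i x M \<and> invertible_matrix F n M \<longrightarrow>
        (\<exists>st. exec F p (cbm_input F n k i x) = Some st
            \<and> inverse_matrix F n M (arr st ''inv'')
            \<and> real (cost st) \<le> C * (real k ^ 3 * real n + real k ^ 5) + real k * real n ^ 2))"

end

theory Submission
  imports Defs "HOL-Algebra.Generated_Fields" "HOL-Algebra.Weak_Morphisms" "HOL-Library.Countable_Set"
begin

text \<open>
  Put \<open>m = k - 1\<close>. Listed cyclically from a suitable index, the entries \<open>z\<^sub>0, z\<^sub>1, \<dots>\<close> of a column of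
  the inverse satisfy one linear equation per matrix row \<open>c\<close>, in the \<open>k\<close> unknowns
  \<open>z\<^sub>c, \<dots>, z\<^sub>c\<^sub>+\<^sub>m\<close>. Its last coefficient is nonzero, so the column is determined by
  \<open>z\<^sub>0, \<dots>, z\<^sub>m\<^sub>-\<^sub>1\<close> through a recurrence that costs \<open>m\<close> multiplications per entry; this is the
  term \<open>k n\<^sup>2\<close>.

  The initial values come from the periodicity conditions \<open>z\<^sub>q = z\<^sub>n\<^sub>+\<^sub>q\<close>, \<open>q < m\<close>. Eliminating
  \<open>z\<^sub>n\<^sub>+\<^sub>m\<^sub>-\<^sub>1, \<dots>, z\<^sub>m\<close> from them by means of the equations \<open>n - 1, \<dots>, 0\<close>, while recording the
  coefficients of the right-hand sides, turns them into an \<open>m \<times> m\<close> system for all \<open>n\<close> columns at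
  once, which is solved by Gauss-Jordan elimination. It is nonsingular because a vector in its kernel
  extends to a periodic solution of the homogeneous equations, that is, to a vector in the kernel of
  the invertible matrix. Both eliminations cost \<open>O(k\<^sup>2 n)\<close>.

  For the transfer between types, a run over a field \<open>F\<close> stays inside the countable subfield generated
  by the coefficients and the entries of the inverse, which is isomorphic to a field on a set of
  natural numbers.
\<close>

section \<open>Transfer to fields on other types\<close>

datatype fterm = TOne | TGen nat | TUminus fterm | TInv fterm | TAdd fterm fterm | TMult fterm fterm

instance fterm :: countable by countable_datatype

text \<open>Every element of the generated subfield is the value of some formal expression, and
  there are only countably many expressions because a generator enters only through its
  number.\<close>

lemma countable_generate_field:
  assumes "countable S"
  shows "countable (generate_field F S)"
proof -
  \<comment> \<open>Only surjectivity onto the subfield matters, so it is harmless that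
    \<open>ev\<close> is also defined on terms without meaning, such as an inverse of zero or a
    number that enumerates nothing.\<close>
  define ev where "ev = rec_fterm \<one>\<^bsub>F\<^esub> (from_nat_into S) (\<lambda>_ a. \<ominus>\<^bsub>F\<^esub> a) (\<lambda>_ a. inv\<^bsub>F\<^esub> a)
    (\<lambda>_ _ a b. a \<oplus>\<^bsub>F\<^esub> b) (\<lambda>_ _ a b. a \<otimes>\<^bsub>F\<^esub> b)"
  have "a \<in> range ev" if "a \<in> generate_field F S" for a
    using that
  proof induction
    case one
    show ?case by (rule range_eqI[of _ _ TOne]) (simp add: ev_def)
  next
    case (incl h)
    then show ?case
      using assms by (intro range_eqI[of _ _ "TGen (to_nat_on S h)"]) (simp add: ev_def)
  next
    case (a_inv h)
    then obtain s where "h = ev s" by auto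
    then show ?case by (intro range_eqI[of _ _ "TUminus s"]) (simp add: ev_def)
  next
    case (m_inv h)
    then obtain s where "h = ev s" by auto
    then show ?case by (intro range_eqI[of _ _ "TInv s"]) (simp add: ev_def)
  next
    case (eng_add h1 h2)
    then obtain s t where "h1 = ev s" "h2 = ev t" by auto
    then show ?case by (intro range_eqI[of _ _ "TAdd s t"]) (simp add: ev_def)
  next
    case (eng_mult h1 h2)
    then obtain s t where "h1 = ev s" "h2 = ev t" by auto
    then show ?case by (intro range_eqI[of _ _ "TMult s t"]) (simp add: ev_def)
  qed
  then have "generate_field F S \<subseteq> range ev" by blast
  then show ?thesis by (rule countable_subset) simp
qed

text \<open>The subfield generated by \<open>S\<close> is countable, so its structure can be
  transported along an injection into the natural numbers; \<open>g\<close> undoes this injection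
  and then includes the subfield into \<open>F\<close>.\<close>

lemma countable_subset_of_nat_field:
  fixes F :: "'a ring"
  assumes "field F" "countable S" "S \<subseteq> carrier F"
  obtains F' :: "nat ring" and g
  where "field F'" "g \<in> ring_hom F' F" "S \<subseteq> g ` carrier F'"
proof -
  define K where "K = F\<lparr>carrier := generate_field F S\<rparr>"
  have K: "field K"
    unfolding K_def using assms by (intro field.generate_field_is_field)
  then interpret K: field K .
  have cK: "carrier K = generate_field F S" by (simp add: K_def)
  have sub: "carrier K \<subseteq> carrier F"
    unfolding cK using assms field.generate_field_incl by blast
  define h where "h = to_nat_on (carrier K)"
  have inj: "inj_on h (carrier K)"
    unfolding h_def cK by (intro inj_on_to_nat_on countable_generate_field assms)
  define F' where "F' = image_ring h K"
  have F': "field F'"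
    unfolding F'_def by (rule K.inj_imp_image_ring_is_field[OF inj])
  define g where "g = inv_into (carrier K) h"
  have iso: "g \<in> ring_iso F' K"
    unfolding g_def F'_def by (rule ring_iso_set_sym[OF K.ring_axioms inj_imp_image_ring_iso[OF inj]])
  have "g \<in> ring_hom F' F"
    using iso sub unfolding ring_iso_def ring_hom_def K_def by auto
  moreover have "g ` carrier F' = carrier K"
    using iso by (auto simp: ring_iso_def bij_betw_def)
  then have "S \<subseteq> g ` carrier F'"
    unfolding cK by (auto intro: generate_field.incl)
  ultimately show ?thesis using F' that by blast
qed

section \<open>Runs under field homomorphisms\<close>

definition closed_state :: "'a ring \<Rightarrow> 'a state \<Rightarrow> bool" where
  "closed_state F st \<longleftrightarrow> (\<forall>a p q. arr st a p q \<in> carrier F)"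

lemma closed_stateD: "closed_state F st \<Longrightarrow> arr st a p q \<in> carrier F"
  by (simp add: closed_state_def)

lemma closed_iput [simp]: "closed_state F (iput a m st) = closed_state F st"
  by (simp add: closed_state_def iput_def)

lemma closed_cost [simp]: "closed_state F (st\<lparr>cost := m\<rparr>) = closed_state F st"
  by (simp add: closed_state_def)

lemma closed_fput: "closed_state F st \<Longrightarrow> z \<in> carrier F \<Longrightarrow> closed_state F (fput d z st)"
  by (cases d) (simp add: closed_state_def)

lemma closed_fget: "closed_state F st \<Longrightarrow> fget a st \<in> carrier F"
  by (cases a) (simp add: closed_state_def)

lemma farith_val_closed:
  assumes "field F" "a \<in> carrier F" "b \<in> carrier F" "farith_val F f a b = Some z"
  shows "z \<in> carrier F"
proof -
  interpret field F by fact
  show ?thesis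
    using assms(2-4) by (cases f) (auto simp: field_Units split: if_splits)
qed

text \<open>Needed throughout: the laws of the field, and later those of a homomorphism, hold for
  elements of the carrier only.\<close>

lemma exec_closed:
  assumes "field F" "closed_state F st" "exec F p st = Some st'"
  shows "closed_state F st'"
proof -
  interpret field F by fact
  show ?thesis
    using assms(2,3)
  proof (induction p arbitrary: st st')
    case (Seq p q)
    from Seq.prems(2) obtain st1 where "exec F p st = Some st1" "exec F q st1 = Some st'"
      by (simp add: bind_eq_Some_conv) blast
    then show ?case using Seq.IH(1)[of st st1] Seq.IH(2)[of st1 st'] Seq.prems(1) by simp
  next
    case (FOp f d a b)
    from FOp.prems(2) obtain z where z: "farith_val F f (fget a st) (fget b st) = Some z"
      and st': "st' = fput d z (st\<lparr>cost := cost st + farith_cost f\<rparr>)"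
      by auto
    have "z \<in> carrier F"
      by (rule farith_val_closed[OF assms(1) _ _ z]) (simp_all add: closed_fget FOp.prems)
    then show ?case
      unfolding st' by (intro closed_fput) (simp_all add: FOp.prems)
  next
    case (For a e p)
    have "closed_state F st'"
      if "fold (\<lambda>j so. Option.bind so (\<lambda>st'. exec F p (iput a j st'))) [0..<N] (Some st) = Some st'"
      for N st'
      using that
    proof (induction N arbitrary: st')
      case 0
      then show ?case using For.prems by simp
    next
      case (Suc N)
      then obtain st1 where
        st1: "fold (\<lambda>j so. Option.bind so (\<lambda>st'. exec F p (iput a j st'))) [0..<N] (Some st) = Some st1"
        "exec F p (iput a N st1) = Some st'"
        by (simp add: bind_eq_Some_conv) blast
      show ?case
        by (rule For.IH[OF _ st1(2)]) (simp add: Suc.IH[OF st1(1)])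
    qed
    then show ?case using For.prems(2) by simp
  next
    case (IfZero a p q)
    show ?case using IfZero.prems IfZero.IH[of st st'] by (simp split: if_splits)
  next
    case (IfLess e f p q)
    show ?case using IfLess.prems IfLess.IH[of st st'] by (simp split: if_splits)
  qed (auto intro: closed_fput)
qed

definition map_state :: "('a \<Rightarrow> 'b) \<Rightarrow> 'a state \<Rightarrow> 'b state" where
  "map_state g st = \<lparr>ivar = ivar st, arr = (\<lambda>a p q. g (arr st a p q)), cost = cost st\<rparr>"

lemma map_state_sel [simp]:
  "ivar (map_state g st) = ivar st"
  "arr (map_state g st) a p q = g (arr st a p q)"
  "cost (map_state g st) = cost st"
  by (simp_all add: map_state_def)

lemma map_state_iput [simp]: "iput a m (map_state g st) = map_state g (iput a m st)"
  by (simp add: map_state_def iput_def)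

lemma map_state_fget [simp]: "fget l (map_state g st) = g (fget l st)"
  by (cases l) simp

lemma map_state_fput: "fput l (g z) (map_state g st) = map_state g (fput l z st)"
  by (cases l) (auto simp: map_state_def fun_eq_iff)

lemma map_state_cost: "(map_state g st)\<lparr>cost := m\<rparr> = map_state g (st\<lparr>cost := m\<rparr>)"
  by (simp add: map_state_def)

locale field_hom = F': field F' + F: field F for F' :: "'b ring" and F :: "'a ring" +
  fixes g
  assumes hom: "g \<in> ring_hom F' F"
begin

sublocale ring_hom_cring F' F g
  by unfold_locales (rule hom)

lemma hom_inv:
  assumes "b \<in> carrier F'" "b \<noteq> \<zero>\<^bsub>F'\<^esub>"
  shows "g b \<noteq> \<zero>\<^bsub>F\<^esub>" "inv\<^bsub>F\<^esub> (g b) = g (inv\<^bsub>F'\<^esub> b)"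
proof -
  have i: "inv\<^bsub>F'\<^esub> b \<in> carrier F'" "b \<otimes>\<^bsub>F'\<^esub> inv\<^bsub>F'\<^esub> b = \<one>\<^bsub>F'\<^esub>"
    using assms F'.field_Units by auto
  then have "g b \<otimes>\<^bsub>F\<^esub> g (inv\<^bsub>F'\<^esub> b) = \<one>\<^bsub>F\<^esub>"
    using assms by (metis hom_mult hom_one)
  then show "g b \<noteq> \<zero>\<^bsub>F\<^esub>" "inv\<^bsub>F\<^esub> (g b) = g (inv\<^bsub>F'\<^esub> b)"
    using assms i by (auto intro!: F.comm_inv_char)
qed

lemma hom_eq_zero_iff: "b \<in> carrier F' \<Longrightarrow> g b = \<zero>\<^bsub>F\<^esub> \<longleftrightarrow> b = \<zero>\<^bsub>F'\<^esub>"
  using hom_inv by auto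

lemma hom_inj:
  assumes "a \<in> carrier F'" "b \<in> carrier F'"
  shows "g a = g b \<longleftrightarrow> a = b"
proof
  assume "g a = g b"
  then have "g (a \<ominus>\<^bsub>F'\<^esub> b) = \<zero>\<^bsub>F\<^esub>"
    using assms by (simp add: a_minus_def F.r_neg)
  moreover have "a \<ominus>\<^bsub>F'\<^esub> b \<in> carrier F'" using assms by simp
  ultimately have "a \<ominus>\<^bsub>F'\<^esub> b = \<zero>\<^bsub>F'\<^esub>" using hom_eq_zero_iff by blast
  then show "a = b" using assms by (simp only: F'.r_right_minus_eq)
qed simp

lemma farith_val_hom:
  assumes "a \<in> carrier F'" "b \<in> carrier F'"
  shows "farith_val F f (g a) (g b) = map_option g (farith_val F' f a b)"
  using assms hom_inv[of b] F'.field_Units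
  by (cases f) (auto simp: a_minus_def)

text \<open>Field elements influence a run only through zero tests and through the abortion of
  divisions by zero. A homomorphism of fields is injective and therefore respects both, while
  control variables and cost are untouched by it.\<close>

lemma exec_hom:
  assumes "closed_state F' st"
  shows "exec F p (map_state g st) = map_option (map_state g) (exec F' p st)"
  using assms
proof (induction p arbitrary: st)
  case (Seq p q)
  then show ?case
    by (cases "exec F' p st") (auto dest: exec_closed[OF F'.field_axioms])
next
  case (FZero d)
  show ?case using map_state_fput[of d g "\<zero>\<^bsub>F'\<^esub>"] by simp
next
  case (FOne d)
  show ?case using map_state_fput[of d g "\<one>\<^bsub>F'\<^esub>"] by simp
next
  case (FOp f d a b)
  then show ?case
    by (auto simp: farith_val_hom closed_fget option.map_comp comp_def map_state_fput map_state_cost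
        intro!: map_option_cong)
next
  case (IfZero a p q)
  then show ?case by (simp add: hom_eq_zero_iff closed_fget)
next
  case (For a e p)
  have "fold (\<lambda>j so. Option.bind so (\<lambda>st. exec F p (iput a j st))) [0..<N] (Some (map_state g st))
    = map_option (map_state g)
        (fold (\<lambda>j so. Option.bind so (\<lambda>st. exec F' p (iput a j st))) [0..<N] (Some st))" for N
  proof (induction N)
    case (Suc N)
    \<comment> \<open>The first \<open>N\<close> iterations are themselves a run of a program,
      namely of the loop with constant bound \<open>N\<close>.\<close>
    have "closed_state F' st'"
      if "fold (\<lambda>j so. Option.bind so (\<lambda>st. exec F' p (iput a j st))) [0..<N] (Some st) = Some st'" for st'
      using exec_closed[OF F'.field_axioms For.prems, of "For a (Num N) p" st'] that by simp
    then show ?case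
      using Suc.IH For.IH
      by (cases "fold (\<lambda>j so. Option.bind so (\<lambda>st. exec F' p (iput a j st))) [0..<N] (Some st)") auto
  qed simp
  then show ?case by simp
qed auto

lemma cbm_input_hom:
  "cbm_input F n k i (\<lambda>s r. g (x s r)) = map_state g (cbm_input F' n k i x)"
  by (auto simp: cbm_input_def map_state_def fun_eq_iff)

text \<open>The equations for the image matrices are the images of the original equations, and
  injectivity makes this an equivalence. One direction pulls invertibility back to the small field,
  the other carries the computed inverse forward.\<close>

lemma inverse_matrix_hom:
  assumes "\<And>r c. r \<in> {1..n} \<Longrightarrow> c \<in> {1..n} \<Longrightarrow> M r c \<in> carrier F'"
    and "\<And>r c. r \<in> {1..n} \<Longrightarrow> c \<in> {1..n} \<Longrightarrow> N r c \<in> carrier F'"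
  shows "inverse_matrix F n (\<lambda>r c. g (M r c)) (\<lambda>r c. g (N r c)) \<longleftrightarrow> inverse_matrix F' n M N"
proof -
  have sum: "(\<Oplus>\<^bsub>F\<^esub>l\<in>{1..n}. g (A r l) \<otimes>\<^bsub>F\<^esub> g (B l c)) = (if r = c then \<one>\<^bsub>F\<^esub> else \<zero>\<^bsub>F\<^esub>) \<longleftrightarrow>
     (\<Oplus>\<^bsub>F'\<^esub>l\<in>{1..n}. A r l \<otimes>\<^bsub>F'\<^esub> B l c) = (if r = c then \<one>\<^bsub>F'\<^esub> else \<zero>\<^bsub>F'\<^esub>)"
    if *: "r \<in> {1..n}" "c \<in> {1..n}" "\<And>r c. r \<in> {1..n} \<Longrightarrow> c \<in> {1..n} \<Longrightarrow> A r c \<in> carrier F'"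
      "\<And>r c. r \<in> {1..n} \<Longrightarrow> c \<in> {1..n} \<Longrightarrow> B r c \<in> carrier F'" for A B :: "nat \<Rightarrow> nat \<Rightarrow> 'b" and r c
  proof -
    have "(\<Oplus>\<^bsub>F\<^esub>l\<in>{1..n}. g (A r l) \<otimes>\<^bsub>F\<^esub> g (B l c)) = (\<Oplus>\<^bsub>F\<^esub>l\<in>{1..n}. (g \<circ> (\<lambda>l. A r l \<otimes>\<^bsub>F'\<^esub> B l c)) l)"
      using * by (intro F.finsum_cong') simp_all
    also have "\<dots> = g (\<Oplus>\<^bsub>F'\<^esub>l\<in>{1..n}. A r l \<otimes>\<^bsub>F'\<^esub> B l c)"
      using * by (subst hom_finsum) (simp_all add: comp_def)
    finally have eq: "(\<Oplus>\<^bsub>F\<^esub>l\<in>{1..n}. g (A r l) \<otimes>\<^bsub>F\<^esub> g (B l c)) = g (\<Oplus>\<^bsub>F'\<^esub>l\<in>{1..n}. A r l \<otimes>\<^bsub>F'\<^esub> B l c)" .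
    have cl: "(\<Oplus>\<^bsub>F'\<^esub>l\<in>{1..n}. A r l \<otimes>\<^bsub>F'\<^esub> B l c) \<in> carrier F'"
      using * by (intro F'.finsum_closed) simp
    have "g s = (if r = c then \<one>\<^bsub>F\<^esub> else \<zero>\<^bsub>F\<^esub>) \<longleftrightarrow> s = (if r = c then \<one>\<^bsub>F'\<^esub> else \<zero>\<^bsub>F'\<^esub>)"
      if "s \<in> carrier F'" for s
      using hom_inj[OF that F'.one_closed] hom_inj[OF that F'.zero_closed] by simp
    from this[OF cl] show ?thesis unfolding eq .
  qed
  show ?thesis
    unfolding inverse_matrix_def
  proof (intro ball_cong refl)
    fix r c assume rc: "r \<in> {1..n}" "c \<in> {1..n}"
    show "(g (N r c) \<in> carrier F
        \<and> (\<Oplus>\<^bsub>F\<^esub>l\<in>{1..n}. g (M r l) \<otimes>\<^bsub>F\<^esub> g (N l c)) = (if r = c then \<one>\<^bsub>F\<^esub> else \<zero>\<^bsub>F\<^esub>)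
        \<and> (\<Oplus>\<^bsub>F\<^esub>l\<in>{1..n}. g (N r l) \<otimes>\<^bsub>F\<^esub> g (M l c)) = (if r = c then \<one>\<^bsub>F\<^esub> else \<zero>\<^bsub>F\<^esub>)) =
      (N r c \<in> carrier F'
        \<and> (\<Oplus>\<^bsub>F'\<^esub>l\<in>{1..n}. M r l \<otimes>\<^bsub>F'\<^esub> N l c) = (if r = c then \<one>\<^bsub>F'\<^esub> else \<zero>\<^bsub>F'\<^esub>)
        \<and> (\<Oplus>\<^bsub>F'\<^esub>l\<in>{1..n}. N r l \<otimes>\<^bsub>F'\<^esub> M l c) = (if r = c then \<one>\<^bsub>F'\<^esub> else \<zero>\<^bsub>F'\<^esub>))"
      using sum[OF rc, of M N, OF assms] sum[OF rc, of N M, OF assms(2) assms(1)]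
        assms(2)[OF rc] hom_closed[OF assms(2)[OF rc]]
      by (simp only: simp_thms)
  qed
qed

end

lemma inverse_matrix_cong:
  fixes F :: "'a ring"
  assumes "ring F"
    and A: "\<And>r c. r \<in> {1..n} \<Longrightarrow> c \<in> {1..n} \<Longrightarrow> A r c = A' r c \<and> A r c \<in> carrier F"
    and B: "\<And>r c. r \<in> {1..n} \<Longrightarrow> c \<in> {1..n} \<Longrightarrow> B r c = B' r c \<and> B r c \<in> carrier F"
  shows "inverse_matrix F n A B = inverse_matrix F n A' B'"
proof -
  interpret ring F by fact
  have cong: "(\<Oplus>\<^bsub>F\<^esub>l\<in>{1..n}. A r l \<otimes>\<^bsub>F\<^esub> B l c) = (\<Oplus>\<^bsub>F\<^esub>l\<in>{1..n}. A' r l \<otimes>\<^bsub>F\<^esub> B' l c)"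
    "(\<Oplus>\<^bsub>F\<^esub>l\<in>{1..n}. B r l \<otimes>\<^bsub>F\<^esub> A l c) = (\<Oplus>\<^bsub>F\<^esub>l\<in>{1..n}. B' r l \<otimes>\<^bsub>F\<^esub> A' l c)"
    if "r \<in> {1..n}" "c \<in> {1..n}" for r c
  proof -
    have "A' r' c' \<in> carrier F" "B' r' c' \<in> carrier F" "A r' c' = A' r' c'" "B r' c' = B' r' c'"
      if "r' \<in> {1..n}" "c' \<in> {1..n}" for r' c'
      using A[OF that] B[OF that] by metis+
    then show "(\<Oplus>\<^bsub>F\<^esub>l\<in>{1..n}. A r l \<otimes>\<^bsub>F\<^esub> B l c) = (\<Oplus>\<^bsub>F\<^esub>l\<in>{1..n}. A' r l \<otimes>\<^bsub>F\<^esub> B' l c)"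
      "(\<Oplus>\<^bsub>F\<^esub>l\<in>{1..n}. B r l \<otimes>\<^bsub>F\<^esub> A l c) = (\<Oplus>\<^bsub>F\<^esub>l\<in>{1..n}. B' r l \<otimes>\<^bsub>F\<^esub> A' l c)"
      using that by (intro finsum_cong'; simp)+
  qed
  show ?thesis
    unfolding inverse_matrix_def
  proof (intro ball_cong refl)
    fix r c assume rc: "r \<in> {1..n}" "c \<in> {1..n}"
    show "(B r c \<in> carrier F
        \<and> (\<Oplus>\<^bsub>F\<^esub>l\<in>{1..n}. A r l \<otimes>\<^bsub>F\<^esub> B l c) = (if r = c then \<one>\<^bsub>F\<^esub> else \<zero>\<^bsub>F\<^esub>)
        \<and> (\<Oplus>\<^bsub>F\<^esub>l\<in>{1..n}. B r l \<otimes>\<^bsub>F\<^esub> A l c) = (if r = c then \<one>\<^bsub>F\<^esub> else \<zero>\<^bsub>F\<^esub>)) =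
      (B' r c \<in> carrier F
        \<and> (\<Oplus>\<^bsub>F\<^esub>l\<in>{1..n}. A' r l \<otimes>\<^bsub>F\<^esub> B' l c) = (if r = c then \<one>\<^bsub>F\<^esub> else \<zero>\<^bsub>F\<^esub>)
        \<and> (\<Oplus>\<^bsub>F\<^esub>l\<in>{1..n}. B' r l \<otimes>\<^bsub>F\<^esub> A' l c) = (if r = c then \<one>\<^bsub>F\<^esub> else \<zero>\<^bsub>F\<^esub>))"
      unfolding cong[OF rc] using B[OF rc] by simp
  qed
qed

text \<open>The coefficients are pulled back along \<open>g\<close> to a field on natural numbers,
  the program is run there, and its final state is mapped back by \<open>g\<close>. The run over
  \<open>F\<close> has the same cost and yields the image of the inverse.\<close>

lemma inverts_cbms_transfer:
  assumes nat: "inverts_cbms TYPE(nat) p C"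
  shows "inverts_cbms TYPE('a) p C"
  unfolding inverts_cbms_def
proof (intro allI impI, elim conjE)
  fix F :: "'a ring" and n k i :: nat and x M
  assume F: "field F" and k: "2 \<le> k" "k \<le> n" and cbm: "is_cbm F n k i x M"
    and "invertible_matrix F n M"
  then obtain N where N: "inverse_matrix F n M N" by (auto simp: invertible_matrix_def)
  interpret F: field F by fact
  have M: "M r c \<in> insert \<zero>\<^bsub>F\<^esub> ((\<lambda>(s, r). x s r) ` ({1..k} \<times> {1..n}))"
    if "r \<in> {1..n}" "c \<in> {1..n}" for r c
  proof (cases "\<exists>s\<in>{1..k}. [int c = int r + int s - int i] (mod int n)")
    case True
    then obtain s where s: "s \<in> {1..k}" "[int c = int r + int s - int i] (mod int n)" by blast
    then have "M r c = x s r" using cbm that unfolding is_cbm_def by blast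
    then show ?thesis using s that by force
  next
    case False
    then have "M r c = \<zero>\<^bsub>F\<^esub>" using cbm that unfolding is_cbm_def by blast
    then show ?thesis by simp
  qed
  \<comment> \<open>The entries of \<open>N\<close> are included so that the inverse can be pulled
    back together with the matrix.\<close>
  define S where "S = insert \<zero>\<^bsub>F\<^esub> ((\<lambda>(s, r). x s r) ` ({1..k} \<times> {1..n})) \<union> (\<lambda>(r, c). N r c) ` ({1..n} \<times> {1..n})"
  have "countable S" "S \<subseteq> carrier F"
    using cbm N by (auto simp: S_def is_cbm_def inverse_matrix_def countable_finite)
  from countable_subset_of_nat_field[OF F this]
  obtain F' :: "nat ring" and g where F': "field F'" and g: "g \<in> ring_hom F' F" and S: "S \<subseteq> g ` carrier F'"
    by blast
  interpret field_hom F' F g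
    using F F' g by (simp add: field_hom_def field_hom_axioms_def)
  define h where "h = inv_into (carrier F') g"
  have h: "h s \<in> carrier F'" "g (h s) = s" if "s \<in> S" for s
    using S that by (auto simp: h_def inv_into_into f_inv_into_f)
  have x: "x s r \<in> S" if "s \<in> {1..k}" "r \<in> {1..n}" for s r
    using that by (auto simp: S_def)
  have MS: "M r c \<in> S" if "r \<in> {1..n}" "c \<in> {1..n}" for r c
    using M[OF that] by (auto simp: S_def)
  have NS: "N r c \<in> S" if "r \<in> {1..n}" "c \<in> {1..n}" for r c
    using that by (auto simp: S_def)
  have zS: "\<zero>\<^bsub>F\<^esub> \<in> S" by (simp add: S_def)
  have h0: "h \<zero>\<^bsub>F\<^esub> = \<zero>\<^bsub>F'\<^esub>"
    using hom_inj[OF h(1)[OF zS] F'.zero_closed] h(2)[OF zS] by simp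
  note cong = inverse_matrix_cong[OF F.ring_axioms]
  \<comment> \<open>As \<open>h\<close> is a right inverse of \<open>g\<close> on \<open>S\<close>,
    it keeps distinct coefficients distinct and nonzero ones nonzero.\<close>
  have "is_cbm F' n k i (\<lambda>s r. h (x s r)) (\<lambda>r c. h (M r c))"
    unfolding is_cbm_def
  proof (intro conjI ballI impI)
    show "i \<in> {1..k}" using cbm by (simp add: is_cbm_def)
    show "h (x s r) \<in> carrier F'" if "s \<in> {1..k}" "r \<in> {1..n}" for s r
      using h x that by blast
    show "h (x k r) \<noteq> \<zero>\<^bsub>F'\<^esub>" if "r \<in> {1..n}" for r
    proof
      assume "h (x k r) = \<zero>\<^bsub>F'\<^esub>"
      then have "x k r = \<zero>\<^bsub>F\<^esub>" using h(2)[OF x[of k r]] that k by simp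
      then show False using cbm that by (auto simp: is_cbm_def)
    qed
    show "h (M r c) = h (x s r)" if "r \<in> {1..n}" "c \<in> {1..n}" "s \<in> {1..k}"
      "[int c = int r + int s - int i] (mod int n)" for r c s
      using cbm that by (auto simp: is_cbm_def)
    show "h (M r c) = \<zero>\<^bsub>F'\<^esub>" if "r \<in> {1..n}" "c \<in> {1..n}"
      "\<forall>s\<in>{1..k}. \<not> [int c = int r + int s - int i] (mod int n)" for r c
      using cbm that h0 by (auto simp: is_cbm_def)
    obtain s r r' where "s \<in> {1..k}" "r \<in> {1..n}" "r' \<in> {1..n}" "x s r \<noteq> x s r'"
      using cbm by (auto simp: is_cbm_def)
    then show "\<exists>s\<in>{1..k}. \<exists>r\<in>{1..n}. \<exists>r'\<in>{1..n}. h (x s r) \<noteq> h (x s r')"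
      using h(2) x by metis
  qed
  moreover have "inverse_matrix F' n (\<lambda>r c. h (M r c)) (\<lambda>r c. h (N r c))"
  proof -
    have "inverse_matrix F n M N \<longleftrightarrow> inverse_matrix F n (\<lambda>r c. g (h (M r c))) (\<lambda>r c. g (h (N r c)))"
      by (rule cong) (use h(2) MS NS \<open>S \<subseteq> carrier F\<close> in \<open>simp_all add: subset_iff\<close>)
    with N have "inverse_matrix F n (\<lambda>r c. g (h (M r c))) (\<lambda>r c. g (h (N r c)))" by simp
    then show ?thesis
      by (subst (asm) inverse_matrix_hom) (simp_all add: h(1) MS NS)
  qed
  ultimately obtain st where st: "exec F' p (cbm_input F' n k i (\<lambda>s r. h (x s r))) = Some st"
    and inv: "inverse_matrix F' n (\<lambda>r c. h (M r c)) (arr st ''inv'')"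
    and cost: "real (cost st) \<le> C * (real k ^ 3 * real n + real k ^ 5) + real k * real n ^ 2"
    using nat F' k unfolding inverts_cbms_def invertible_matrix_def by blast
  have "closed_state F' (cbm_input F' n k i (\<lambda>s r. h (x s r)))"
    using h(1)[OF x] by (simp add: closed_state_def cbm_input_def)
  note closed = exec_closed[OF F' this st] and run = exec_hom[OF this, of p]
  have "cbm_input F n k i x = cbm_input F n k i (\<lambda>s r. g (h (x s r)))"
    using h(2)[OF x] by (simp add: cbm_input_def fun_eq_iff)
  then have "exec F p (cbm_input F n k i x) = Some (map_state g st)"
    using run st by (simp add: cbm_input_hom)
  moreover have "inverse_matrix F n M (arr (map_state g st) ''inv'')"
  proof -
    have "inverse_matrix F n (\<lambda>r c. g (h (M r c))) (\<lambda>r c. g (arr st ''inv'' r c))"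
      using inv by (subst inverse_matrix_hom) (simp_all add: h(1) MS closed_stateD[OF closed])
    moreover have "inverse_matrix F n (\<lambda>r c. g (h (M r c))) (\<lambda>r c. g (arr st ''inv'' r c)) \<longleftrightarrow>
        inverse_matrix F n M (arr (map_state g st) ''inv'')"
      by (rule cong) (use h MS \<open>S \<subseteq> carrier F\<close> in \<open>simp_all add: subset_iff closed_stateD[OF closed]\<close>)
    ultimately show ?thesis by simp
  qed
  ultimately show "\<exists>st. exec F p (cbm_input F n k i x) = Some st \<and> inverse_matrix F n M (arr st ''inv'') \<and>
    real (cost st) \<le> C * (real k ^ 3 * real n + real k ^ 5) + real k * real n ^ 2"
    using cost by auto
qed

section \<open>Weakest preconditions of loop programs\<close>

primrec ivars :: "prog \<Rightarrow> string set" where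
  "ivars Skip = {}"
| "ivars (Seq p q) = ivars p \<union> ivars q"
| "ivars (ISet a e) = {a}"
| "ivars (FZero d) = {}"
| "ivars (FOne d) = {}"
| "ivars (FOp f d a b) = {}"
| "ivars (IfZero a p q) = ivars p \<union> ivars q"
| "ivars (IfLess e f p q) = ivars p \<union> ivars q"
| "ivars (For a e p) = insert a (ivars p)"

primrec larr :: "loc \<Rightarrow> string" where
  "larr (Loc a e f) = a"

primrec arrs :: "prog \<Rightarrow> string set" where
  "arrs Skip = {}"
| "arrs (Seq p q) = arrs p \<union> arrs q"
| "arrs (ISet a e) = {}"
| "arrs (FZero d) = {larr d}"
| "arrs (FOne d) = {larr d}"
| "arrs (FOp f d a b) = {larr d}"
| "arrs (IfZero a p q) = arrs p \<union> arrs q"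
| "arrs (IfLess e f p q) = arrs p \<union> arrs q"
| "arrs (For a e p) = arrs p"

lemma iput_sel [simp]:
  "ivar (iput a m st) = (ivar st)(a := m)"
  "arr (iput a m st) = arr st"
  "cost (iput a m st) = cost st"
  by (simp_all add: iput_def)

lemma fput_sel [simp]:
  "ivar (fput d z st) = ivar st"
  "cost (fput d z st) = cost st"
  "arr (fput (Loc a e f) z st) b p q =
    (if b = a \<and> p = ival e (ivar st) \<and> q = ival f (ivar st) then z else arr st b p q)"
  by (cases d; simp)+

lemma arr_fput_other: "b \<noteq> larr d \<Longrightarrow> arr (fput d z st) b = arr st b"
  by (cases d) auto

definition unchanged :: "string set \<Rightarrow> string set \<Rightarrow> 'a state \<Rightarrow> 'a state \<Rightarrow> bool" where
  "unchanged V B st st' \<longleftrightarrow> (\<forall>v. v \<notin> V \<longrightarrow> ivar st' v = ivar st v) \<and> (\<forall>b. b \<notin> B \<longrightarrow> arr st' b = arr st b)"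

lemma unchanged_refl: "unchanged V B st st"
  by (simp add: unchanged_def)

lemma unchanged_trans:
  "unchanged V B st st1 \<Longrightarrow> unchanged V' B' st1 st2 \<Longrightarrow> unchanged (V \<union> V') (B \<union> B') st st2"
  by (simp add: unchanged_def)

lemma unchanged_mono: "unchanged V B st st' \<Longrightarrow> V \<subseteq> V' \<Longrightarrow> B \<subseteq> B' \<Longrightarrow> unchanged V' B' st st'"
  unfolding unchanged_def by blast

lemma exec_unchanged: "exec F p st = Some st' \<Longrightarrow> unchanged (ivars p) (arrs p) st st'"
proof (induction p arbitrary: st st')
  case (Seq p q)
  from Seq.prems obtain st1 where "exec F p st = Some st1" "exec F q st1 = Some st'"
    by (auto simp: bind_eq_Some_conv)
  then show ?case using Seq.IH unchanged_trans by fastforce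
next
  case (IfZero a p q)
  from IfZero.prems have "exec F p st = Some st' \<or> exec F q st = Some st'" by (auto split: if_splits)
  then show ?case using IfZero.IH unchanged_mono[of _ _ st st'] by fastforce
next
  case (IfLess e f p q)
  from IfLess.prems have "exec F p st = Some st' \<or> exec F q st = Some st'" by (auto split: if_splits)
  then show ?case using IfLess.IH unchanged_mono[of _ _ st st'] by fastforce
next
  case (For a e p)
  have "unchanged (insert a (ivars p)) (arrs p) st st'"
    if "fold (\<lambda>j so. Option.bind so (\<lambda>st'. exec F p (iput a j st'))) [0..<N] (Some st) = Some st'"
    for N st'
    using that
  proof (induction N arbitrary: st')
    case 0
    then show ?case by (simp add: unchanged_refl)
  next
    case (Suc N)
    from Suc.prems obtain st1 where
      st1: "fold (\<lambda>j so. Option.bind so (\<lambda>st'. exec F p (iput a j st'))) [0..<N] (Some st) = Some st1"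
      "exec F p (iput a N st1) = Some st'"
      by (auto simp: bind_eq_Some_conv)
    from Suc.IH[OF st1(1)] For.IH[OF st1(2)] show ?case
      by (simp add: unchanged_def)
  qed
  then show ?case using For.prems by simp
qed (auto simp: unchanged_def arr_fput_other)

text \<open>Total correctness: the existence of a final state excludes a division by zero.\<close>

definition wp :: "'a ring \<Rightarrow> prog \<Rightarrow> ('a state \<Rightarrow> bool) \<Rightarrow> 'a state \<Rightarrow> bool" where
  "wp F p Q st \<longleftrightarrow> (\<exists>st'. exec F p st = Some st' \<and> Q st')"

lemma wp_simps [simp]:
  "wp F Skip Q st = Q st"
  "wp F (Seq p q) Q st = wp F p (wp F q Q) st"
  "wp F (ISet v e) Q st = Q (iput v (ival e (ivar st)) st)"
  "wp F (FZero d) Q st = Q (fput d \<zero>\<^bsub>F\<^esub> st)"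
  "wp F (FOne d) Q st = Q (fput d \<one>\<^bsub>F\<^esub> st)"
  "wp F (FOp FAdd d a b) Q st = Q (fput d (fget a st \<oplus>\<^bsub>F\<^esub> fget b st) st)"
  "wp F (FOp FSub d a b) Q st = Q (fput d (fget a st \<ominus>\<^bsub>F\<^esub> fget b st) st)"
  "wp F (FOp FMul d a b) Q st =
    Q (fput d (fget a st \<otimes>\<^bsub>F\<^esub> fget b st) (st\<lparr>cost := Suc (cost st)\<rparr>))"
  "wp F (FOp FDiv d a b) Q st = (fget b st \<noteq> \<zero>\<^bsub>F\<^esub> \<and>
    Q (fput d (fget a st \<otimes>\<^bsub>F\<^esub> inv\<^bsub>F\<^esub> fget b st) (st\<lparr>cost := Suc (cost st)\<rparr>)))"
  "wp F (IfZero a p q) Q st = (if fget a st = \<zero>\<^bsub>F\<^esub> then wp F p Q st else wp F q Q st)"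
  "wp F (IfLess e f p q) Q st = (if ival e (ivar st) < ival f (ivar st) then wp F p Q st else wp F q Q st)"
  by (auto simp: wp_def bind_eq_Some_conv)

text \<open>The frame condition and closedness come for free, so that specifications of subprograms
  need to mention only what they change.\<close>

lemma wp_mono:
  assumes "field F" "closed_state F st" "wp F p Q st"
    and "\<And>st'. Q st' \<Longrightarrow> unchanged (ivars p) (arrs p) st st' \<Longrightarrow> closed_state F st' \<Longrightarrow> R st'"
  shows "wp F p R st"
  using assms exec_unchanged exec_closed unfolding wp_def by metis

text \<open>The index of the invariant \<open>I\<close> counts the completed iterations. The cost is
  kept apart from it: a bound \<open>w\<close> for one iteration gives the bound
  \<open>N * w\<close> for the loop.\<close>

lemma wp_For:
  assumes F: "field F" and cl: "closed_state F st" and N: "ival e (ivar st) = N"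
    and base: "I 0 st"
    and step: "\<And>j st'. j < N \<Longrightarrow> I j st' \<Longrightarrow> unchanged (insert a (ivars p)) (arrs p) st st' \<Longrightarrow>
        closed_state F st' \<Longrightarrow> wp F p (\<lambda>s. I (Suc j) s \<and> cost s \<le> cost st' + w) (iput a j st')"
    and fin: "\<And>st'. I N st' \<Longrightarrow> unchanged (insert a (ivars p)) (arrs p) st st' \<Longrightarrow>
        closed_state F st' \<Longrightarrow> cost st' \<le> cost st + N * w \<Longrightarrow> Q st'"
  shows "wp F (For a e p) Q st"
proof -
  \<comment> \<open>Induction on the number of iterations, with the bound of the loop replaced by a
    constant.\<close>
  have "\<exists>st'. exec F (For a (Num j) p) st = Some st' \<and> I j st' \<and> cost st' \<le> cost st + j * w" if "j \<le> N" for j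
    using that
  proof (induction j)
    case 0
    then show ?case using base by simp
  next
    case (Suc j)
    from Suc.IH Suc.prems obtain st1 where st1: "exec F (For a (Num j) p) st = Some st1" "I j st1"
      "cost st1 \<le> cost st + j * w"
      by auto
    have "wp F p (\<lambda>s. I (Suc j) s \<and> cost s \<le> cost st1 + w) (iput a j st1)"
      using exec_unchanged[OF st1(1)] exec_closed[OF F cl st1(1)] Suc.prems st1(2) by (intro step) simp_all
    then obtain st2 where st2: "exec F p (iput a j st1) = Some st2" "I (Suc j) st2" "cost st2 \<le> cost st1 + w"
      unfolding wp_def by blast
    have "exec F (For a (Num (Suc j)) p) st = Some st2"
      using st1(1) st2(1) by simp
    then show ?case using st1 st2 by (intro exI[of _ st2]) simp
  qed
  from this[of N] obtain st' where st': "exec F (For a (Num N) p) st = Some st'" "I N st'"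
    "cost st' \<le> cost st + N * w" by auto
  have "Q st'"
    using exec_unchanged[OF st'(1)] exec_closed[OF F cl st'(1)] st' by (intro fin) simp_all
  moreover have "exec F (For a e p) st = Some st'"
    using st'(1) N by simp
  ultimately show ?thesis by (auto simp: wp_def)
qed

section \<open>Periodic recurrences and row operations\<close>

locale ring_field = field F for F :: "'a ring" (structure)
begin

section \<open>Finite sums over initial segments\<close>

lemma inv_closed [simp]: "a \<in> carrier F \<Longrightarrow> a \<noteq> \<zero> \<Longrightarrow> inv a \<in> carrier F"
  using field_Units by auto

lemma lsum_Suc:
  assumes "\<And>l. g l \<in> carrier F"
  shows "(\<Oplus>l\<in>{..<Suc a :: nat}. g l) = (\<Oplus>l\<in>{..<a :: nat}. g l) \<oplus> g a"
  using assms by (simp add: lessThan_Suc a_comm)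

lemma lsum_split:
  assumes "\<And>l. g l \<in> carrier F"
  shows "(\<Oplus>l\<in>{..<a + b :: nat}. g l) = (\<Oplus>l\<in>{..<a :: nat}. g l) \<oplus> (\<Oplus>t\<in>{..<b}. g (a + t))"
  using assms by (induction b) (simp_all add: lsum_Suc a_assoc)

lemma lsum_cong:
  assumes "\<And>l. l < a \<Longrightarrow> f l = g l" "\<And>l. g l \<in> carrier F"
  shows "(\<Oplus>l\<in>{..<a :: nat}. f l) = (\<Oplus>l\<in>{..<a :: nat}. g l)"
  using assms by (intro finsum_cong') auto

lemma lsum_smult:
  assumes "s \<in> carrier F" "\<And>l. f l \<in> carrier F"
  shows "(\<Oplus>l\<in>{..<a :: nat}. s \<otimes> f l) = s \<otimes> (\<Oplus>l\<in>{..<a :: nat}. f l)"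
  using assms by (subst finsum_rdistr) auto

lemma lsum_add:
  assumes "\<And>l. f l \<in> carrier F" "\<And>l. g l \<in> carrier F"
  shows "(\<Oplus>l\<in>{..<a :: nat}. f l \<oplus> g l) = (\<Oplus>l\<in>{..<a :: nat}. f l) \<oplus> (\<Oplus>l\<in>{..<a :: nat}. g l)"
  using assms by (intro finsum_addf) auto

lemma lsum_zero: "(\<And>l. l < a \<Longrightarrow> f l = \<zero>) \<Longrightarrow> (\<Oplus>l\<in>{..<a :: nat}. f l) = \<zero>"
  by (rule add.finprod_one_eqI) auto

lemma lsum_single:
  assumes "p < a" "\<And>l. f l \<in> carrier F" "\<And>l. l < a \<Longrightarrow> l \<noteq> p \<Longrightarrow> f l = \<zero>"
  shows "(\<Oplus>l\<in>{..<a :: nat}. f l) = f p"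
proof -
  have "(\<Oplus>l\<in>{..<a :: nat}. f l) = (\<Oplus>l\<in>{..<a :: nat}. if p = l then f l else \<zero>)"
    using assms by (intro lsum_cong) auto
  also have "\<dots> = f p"
    using assms by (intro finsum_singleton) auto
  finally show ?thesis .
qed

text \<open>The equations solved for their last unknown. In the application \<open>al\<close> holds
  the other coefficients divided by the last one and \<open>be\<close> the negative of its inverse.
  Periodicity is not part of the notion: the values of \<open>z\<close> from \<open>n\<close> on are
  further unknowns.\<close>

definition solves :: "nat \<Rightarrow> nat \<Rightarrow> (nat \<Rightarrow> nat \<Rightarrow> 'a) \<Rightarrow> (nat \<Rightarrow> 'a) \<Rightarrow> (nat \<Rightarrow> 'a) \<Rightarrow> (nat \<Rightarrow> 'a) \<Rightarrow> bool" where
  "solves n m al be z b \<longleftrightarrow> (\<forall>l. z l \<in> carrier F) \<and> (\<forall>c. b c \<in> carrier F) \<and>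
    (\<forall>c<n. z (c + m) = \<ominus> ((\<Oplus>t\<in>{..<m}. al c t \<otimes> z (c + t)) \<oplus> be c \<otimes> b c))"

text \<open>
  A row holds the coefficients of \<open>z\<^sub>0, \<dots>, z\<^sub>n\<^sub>+\<^sub>m\<^sub>-\<^sub>1\<close> at the positions below \<open>n + m\<close> and, up to sign, those
  of the right-hand sides \<open>b\<^sub>0, \<dots>, b\<^sub>n\<^sub>-\<^sub>1\<close> at the following \<open>n\<close> positions. Once the unknowns
  \<open>z\<^sub>l\<close> with \<open>l \<ge> c0 + m\<close> are eliminated, their positions contain garbage.
\<close>

definition row_inv :: "nat \<Rightarrow> nat \<Rightarrow> (nat \<Rightarrow> nat \<Rightarrow> 'a) \<Rightarrow> (nat \<Rightarrow> 'a) \<Rightarrow> nat \<Rightarrow> nat \<Rightarrow> (nat \<Rightarrow> 'a) \<Rightarrow> bool" where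
  "row_inv n m al be q c0 f \<longleftrightarrow> (\<forall>z b. solves n m al be z b \<longrightarrow>
     z q \<ominus> z (n + q) = (\<Oplus>l\<in>{..<c0 + m}. f l \<otimes> z l) \<ominus> (\<Oplus>c\<in>{c0..<n}. f (n + m + c) \<otimes> b c))"

text \<open>Before any elimination the row is the periodicity condition itself, and no right-hand
  side occurs in it yet.\<close>

lemma row_inv_init:
  assumes "q < m" "m < n" and f: "\<And>l. f l = (if l = q then \<one> else if l = n + q then \<ominus> \<one> else \<zero>)"
  shows "row_inv n m al be q n f"
  unfolding row_inv_def
proof (intro allI impI)
  fix z b assume "solves n m al be z b"
  then have z: "\<And>l. z l \<in> carrier F" and b: "\<And>c. b c \<in> carrier F" by (auto simp: solves_def)
  have "(\<Oplus>l\<in>{..<n + m}. f l \<otimes> z l) =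
      (\<Oplus>l\<in>{..<n + m}. (if l = q then z q else \<zero>) \<oplus> (if l = n + q then \<ominus> z (n + q) else \<zero>))"
    using assms z by (intro lsum_cong) (auto simp: l_minus)
  also have "\<dots> = (\<Oplus>l\<in>{..<n + m}. (if l = q then z q else \<zero>)) \<oplus> (\<Oplus>l\<in>{..<n + m}. (if l = n + q then \<ominus> z (n + q) else \<zero>))"
    using z by (intro lsum_add) auto
  also have "(\<Oplus>l\<in>{..<n + m}. (if l = q then z q else \<zero>)) = z q"
    using lsum_single[of q "n + m" "\<lambda>l. if l = q then z q else \<zero>"] assms z by simp
  also have "(\<Oplus>l\<in>{..<n + m}. (if l = n + q then \<ominus> z (n + q) else \<zero>)) = \<ominus> z (n + q)"
    using lsum_single[of "n + q" "n + m" "\<lambda>l. if l = n + q then \<ominus> z (n + q) else \<zero>"] assms z by simp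
  finally show "z q \<ominus> z (n + q) = (\<Oplus>l\<in>{..<n + m}. f l \<otimes> z l) \<ominus> (\<Oplus>c\<in>{n..<n}. f (n + m + c) \<otimes> b c)"
    using z by (simp add: a_minus_def)
qed

text \<open>Equation \<open>c0\<close> is substituted for \<open>z (c0 + m)\<close>. Its
  coefficient, the factor \<open>f (c0 + m)\<close>, is distributed over the \<open>m\<close>
  preceding unknowns, and its product with \<open>be c0\<close> is recorded as the coefficient of
  \<open>b c0\<close>. Position \<open>c0 + m\<close> may keep its old value, since the sum now ends
  before it.\<close>

lemma row_inv_step:
  assumes inv: "row_inv n m al be q (Suc c0) f" and c0: "c0 < n"
    and f: "\<And>l. f l \<in> carrier F" and f'c: "\<And>l. f' l \<in> carrier F"
    and al: "\<And>c t. al c t \<in> carrier F" and be: "\<And>c. be c \<in> carrier F"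
    and f'W: "f' (n + m + c0) = f (c0 + m) \<otimes> be c0"
    and f'W': "\<And>c. c0 < c \<Longrightarrow> c < n \<Longrightarrow> f' (n + m + c) = f (n + m + c)"
    and f'A: "\<And>t. t < m \<Longrightarrow> f' (c0 + t) = f (c0 + t) \<ominus> f (c0 + m) \<otimes> al c0 t"
    and f'A': "\<And>l. l < c0 \<Longrightarrow> f' l = f l"
  shows "row_inv n m al be q c0 f'"
  unfolding row_inv_def
proof (intro allI impI)
  fix z b assume s: "solves n m al be z b"
  then have z: "\<And>l. z l \<in> carrier F" and b: "\<And>c. b c \<in> carrier F"
    and zc: "z (c0 + m) = \<ominus> ((\<Oplus>t\<in>{..<m}. al c0 t \<otimes> z (c0 + t)) \<oplus> be c0 \<otimes> b c0)"
    using c0 by (auto simp: solves_def)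
  define h where "h = f (c0 + m)"
  define S1 where "S1 = (\<Oplus>l\<in>{..<c0}. f l \<otimes> z l)"
  define S2 where "S2 = (\<Oplus>t\<in>{..<m}. f (c0 + t) \<otimes> z (c0 + t))"
  define S3 where "S3 = (\<Oplus>t\<in>{..<m}. al c0 t \<otimes> z (c0 + t))"
  define W where "W = (\<Oplus>c\<in>{Suc c0..<n}. f (n + m + c) \<otimes> b c)"
  have cl: "h \<in> carrier F" "S1 \<in> carrier F" "S2 \<in> carrier F" "S3 \<in> carrier F" "W \<in> carrier F"
    using f z al b by (auto simp: h_def S1_def S2_def S3_def W_def intro!: finsum_closed)
  have "(\<Oplus>l\<in>{..<Suc c0 + m}. f l \<otimes> z l) = S1 \<oplus> S2 \<oplus> h \<otimes> z (c0 + m)"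
    using f z by (simp add: lsum_Suc lsum_split S1_def S2_def h_def)
  moreover have "(\<Oplus>l\<in>{..<c0 + m}. f' l \<otimes> z l) = S1 \<oplus> (S2 \<ominus> h \<otimes> S3)"
  proof -
    have "(\<Oplus>l\<in>{..<c0}. f' l \<otimes> z l) = S1"
      unfolding S1_def using f'A' f z by (intro lsum_cong) auto
    moreover have "(\<Oplus>t\<in>{..<m}. f' (c0 + t) \<otimes> z (c0 + t)) =
        (\<Oplus>t\<in>{..<m}. f (c0 + t) \<otimes> z (c0 + t) \<oplus> (\<ominus> h) \<otimes> (al c0 t \<otimes> z (c0 + t)))"
    proof (intro lsum_cong)
      fix t assume "t < m"
      have "(x \<ominus> y \<otimes> a) \<otimes> w = x \<otimes> w \<oplus> (\<ominus> y) \<otimes> (a \<otimes> w)"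
        if "x \<in> carrier F" "y \<in> carrier F" "a \<in> carrier F" "w \<in> carrier F" for x y a w
        using that by (simp add: a_minus_def l_distr l_minus m_assoc)
      from this[OF f cl(1) al z]
      show "f' (c0 + t) \<otimes> z (c0 + t) = f (c0 + t) \<otimes> z (c0 + t) \<oplus> (\<ominus> h) \<otimes> (al c0 t \<otimes> z (c0 + t))"
        unfolding f'A[OF \<open>t < m\<close>] h_def[symmetric] .
    qed (use f z al cl in auto)
    moreover have "\<dots> = S2 \<oplus> (\<ominus> h) \<otimes> S3"
      using f z al cl by (subst lsum_add) (auto simp: lsum_smult S2_def S3_def)
    moreover have "\<dots> = S2 \<ominus> h \<otimes> S3"
      using cl by (simp add: a_minus_def l_minus)
    ultimately show ?thesis using f'c z by (simp add: lsum_split)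
  qed
  moreover have "(\<Oplus>c\<in>{c0..<n}. f' (n + m + c) \<otimes> b c) = (h \<otimes> be c0) \<otimes> b c0 \<oplus> W"
  proof -
    have "{c0..<n} = insert c0 {Suc c0..<n}" using c0 by auto
    then have "(\<Oplus>c\<in>{c0..<n}. f' (n + m + c) \<otimes> b c) =
        f' (n + m + c0) \<otimes> b c0 \<oplus> (\<Oplus>c\<in>{Suc c0..<n}. f' (n + m + c) \<otimes> b c)"
      using f'c b by simp
    moreover have "(\<Oplus>c\<in>{Suc c0..<n}. f' (n + m + c) \<otimes> b c) = W"
      unfolding W_def using f b f'W' by (intro finsum_cong') auto
    ultimately show ?thesis by (simp add: f'W h_def)
  qed
  moreover have "z q \<ominus> z (n + q) = (\<Oplus>l\<in>{..<Suc c0 + m}. f l \<otimes> z l) \<ominus> W"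
    using inv s unfolding row_inv_def W_def by blast
  moreover have "S1 \<oplus> S2 \<oplus> h \<otimes> \<ominus> (S3 \<oplus> be c0 \<otimes> b c0) \<ominus> W =
      S1 \<oplus> (S2 \<ominus> h \<otimes> S3) \<ominus> ((h \<otimes> be c0) \<otimes> b c0 \<oplus> W)"
  proof -
    have "s1 \<oplus> s2 \<oplus> x \<otimes> \<ominus> (s3 \<oplus> e \<otimes> d) \<ominus> w = s1 \<oplus> (s2 \<ominus> x \<otimes> s3) \<ominus> ((x \<otimes> e) \<otimes> d \<oplus> w)"
      if "s1 \<in> carrier F" "s2 \<in> carrier F" "s3 \<in> carrier F" "x \<in> carrier F" "e \<in> carrier F"
        "d \<in> carrier F" "w \<in> carrier F" for s1 s2 s3 x e d w
      using that by (simp add: a_minus_def r_distr r_minus minus_add a_ac m_assoc)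
    from this[OF cl(2-4) cl(1) be b cl(5)] show ?thesis .
  qed
  ultimately show "z q \<ominus> z (n + q) = (\<Oplus>l\<in>{..<c0 + m}. f' l \<otimes> z l) \<ominus> (\<Oplus>c\<in>{c0..<n}. f' (n + m + c) \<otimes> b c)"
    by (simp add: zc S3_def)
qed

text \<open>The null space of the augmented rows, right-hand-side columns included, serves as the
  invariant of Gauss-Jordan elimination. A solution of the inhomogeneous system appears in it as a
  vector with entry -1 in the column of its right-hand side.\<close>

definition kern :: "nat \<Rightarrow> nat \<Rightarrow> (nat \<Rightarrow> nat \<Rightarrow> 'a) \<Rightarrow> (nat \<Rightarrow> 'a) set" where
  "kern D m A = {y. (\<forall>l. y l \<in> carrier F) \<and> (\<forall>q<m. (\<Oplus>l\<in>{..<D}. A q l \<otimes> y l) = \<zero>)}"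

text \<open>Row \<open>r\<close> is the same in both matrices because \<open>p \<noteq> r\<close>; a
  vector that annihilates it does not see the multiple added to row \<open>p\<close>.\<close>

lemma kern_add_row:
  assumes A: "\<And>q l. A q l \<in> carrier F" and s: "s \<in> carrier F" and pr: "p \<noteq> r" "r < m"
    and A'p: "\<And>l. l < D \<Longrightarrow> A' p l = A p l \<oplus> s \<otimes> A r l"
    and A': "\<And>q l. q \<noteq> p \<Longrightarrow> l < D \<Longrightarrow> A' q l = A q l"
  shows "kern D m A' = kern D m A"
proof -
  have "(\<forall>q<m. (\<Oplus>l\<in>{..<D}. A' q l \<otimes> y l) = \<zero>) \<longleftrightarrow> (\<forall>q<m. (\<Oplus>l\<in>{..<D}. A q l \<otimes> y l) = \<zero>)"
    if y: "\<And>l. y l \<in> carrier F" for y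
  proof -
    define g where "g q = (\<Oplus>l\<in>{..<D}. A q l \<otimes> y l)" for q
    define g' where "g' q = (\<Oplus>l\<in>{..<D}. A' q l \<otimes> y l)" for q
    have cl: "g q \<in> carrier F" for q using A y by (auto simp: g_def intro!: finsum_closed)
    have other: "g' q = g q" if "q \<noteq> p" for q
      unfolding g_def g'_def using A' A y that by (intro lsum_cong) auto
    have "g' p = (\<Oplus>l\<in>{..<D}. A p l \<otimes> y l \<oplus> s \<otimes> (A r l \<otimes> y l))"
      unfolding g'_def using A y s by (intro lsum_cong) (auto simp: A'p l_distr m_assoc)
    also have "\<dots> = g p \<oplus> s \<otimes> g r"
      unfolding g_def using A y s by (simp add: lsum_add lsum_smult)
    finally have p: "g' p = g p \<oplus> s \<otimes> g r" .
    have "(\<forall>q<m. g' q = \<zero>) \<longleftrightarrow> (\<forall>q<m. g q = \<zero>)"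
      using other p pr s cl by (metis r_null r_zero)
    then show ?thesis by (simp add: g_def g'_def)
  qed
  then show ?thesis unfolding kern_def by auto
qed

lemma kern_scale_row:
  assumes A: "\<And>q l. A q l \<in> carrier F" and s: "s \<in> carrier F" "s \<noteq> \<zero>"
    and A'p: "\<And>l. l < D \<Longrightarrow> A' p l = A p l \<otimes> s"
    and A': "\<And>q l. q \<noteq> p \<Longrightarrow> l < D \<Longrightarrow> A' q l = A q l"
  shows "kern D m A' = kern D m A"
proof -
  have "(\<Oplus>l\<in>{..<D}. A' q l \<otimes> y l) = \<zero> \<longleftrightarrow> (\<Oplus>l\<in>{..<D}. A q l \<otimes> y l) = \<zero>"
    if y: "\<And>l. y l \<in> carrier F" for y q
  proof (cases "q = p")
    case True
    have "(\<Oplus>l\<in>{..<D}. A' q l \<otimes> y l) = (\<Oplus>l\<in>{..<D}. s \<otimes> (A q l \<otimes> y l))"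
      using A y s True by (intro lsum_cong) (auto simp: A'p m_ac)
    also have "\<dots> = s \<otimes> (\<Oplus>l\<in>{..<D}. A q l \<otimes> y l)"
      using A y s by (simp add: lsum_smult)
    finally show ?thesis using A y s by (auto simp: integral_iff)
  next
    case False
    have "(\<Oplus>l\<in>{..<D}. A' q l \<otimes> y l) = (\<Oplus>l\<in>{..<D}. A q l \<otimes> y l)"
      using A y False by (intro lsum_cong) (auto simp: A')
    then show ?thesis by simp
  qed
  then show ?thesis unfolding kern_def by auto
qed

text \<open>For \<open>m \<le> D\<close> this says that the leading \<open>m\<close> by
  \<open>m\<close> block is nonsingular. Expressed through \<open>kern\<close>, it survives row
  operations without further argument.\<close>

definition trivial_kernel :: "nat \<Rightarrow> nat \<Rightarrow> (nat \<Rightarrow> nat \<Rightarrow> 'a) \<Rightarrow> bool" where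
  "trivial_kernel D m A \<longleftrightarrow> (\<forall>y \<in> kern D m A. (\<forall>l. m \<le> l \<longrightarrow> y l = \<zero>) \<longrightarrow> (\<forall>l. y l = \<zero>))"

text \<open>Otherwise column \<open>p\<close> is a combination of the unit columns before it, and
  this linear relation is a nonzero kernel vector supported on the first \<open>m\<close>
  positions.\<close>

lemma pivot_exists:
  assumes A: "\<And>q l. A q l \<in> carrier F" and def: "trivial_kernel D m A" and p: "p < m" "m \<le> D"
    and unit: "\<And>r l. r < m \<Longrightarrow> l < p \<Longrightarrow> A r l = (if r = l then \<one> else \<zero>)"
  shows "\<exists>r. p \<le> r \<and> r < m \<and> A r p \<noteq> \<zero>"
proof (rule ccontr)
  assume "\<not> ?thesis"
  then have zero: "A r p = \<zero>" if "p \<le> r" "r < m" for r using that by auto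
  \<comment> \<open>The relation itself: coefficient 1 for column \<open>p\<close>, and the negated
    entries of column \<open>p\<close> for the unit columns.\<close>
  define y where "y l = (if l < p then \<ominus> A l p else if l = p then \<one> else \<zero>)" for l
  have y: "y l \<in> carrier F" for l using A by (simp add: y_def)
  have "(\<Oplus>l\<in>{..<D}. A q l \<otimes> y l) = \<zero>" if "q < m" for q
  proof -
    have "(\<Oplus>l\<in>{..<D}. A q l \<otimes> y l) = (\<Oplus>l\<in>{..<Suc p + (D - Suc p)}. A q l \<otimes> y l)"
      using p by simp
    also have "\<dots> = (\<Oplus>l\<in>{..<p}. A q l \<otimes> y l) \<oplus> A q p \<oplus> (\<Oplus>t\<in>{..<D - Suc p}. A q (Suc p + t) \<otimes> y (Suc p + t))"
      using A y by (subst lsum_split) (auto simp: lsum_Suc, simp add: y_def)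
    also have "(\<Oplus>t\<in>{..<D - Suc p}. A q (Suc p + t) \<otimes> y (Suc p + t)) = \<zero>"
      using A by (intro lsum_zero) (simp add: y_def)
    also have "(\<Oplus>l\<in>{..<p}. A q l \<otimes> y l) = \<ominus> A q p"
    proof (cases "q < p")
      case True
      have "(\<Oplus>l\<in>{..<p}. A q l \<otimes> y l) = A q q \<otimes> y q"
        using True A y unit that by (intro lsum_single) auto
      also have "\<dots> = \<ominus> A q p" using True unit that A by (simp add: y_def)
      finally show ?thesis .
    next
      case False
      then have "(\<Oplus>l\<in>{..<p}. A q l \<otimes> y l) = \<zero>"
        using unit that y by (intro lsum_zero) auto
      then show ?thesis using zero[of q] False that by simp
    qed
    finally show ?thesis using A by (simp add: l_neg)
  qed
  then have "y \<in> kern D m A" using y by (auto simp: kern_def)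
  moreover have "\<forall>l. m \<le> l \<longrightarrow> y l = \<zero>" using p by (simp add: y_def)
  ultimately have "y p = \<zero>" using def unfolding trivial_kernel_def by blast
  then show False by (simp add: y_def)
qed

end

section \<open>The inversion program\<close>

text \<open>
  Arrays: \<open>L\<close> and \<open>B\<close> hold the normalized equations, \<open>A\<close> the \<open>m\<close> rows described at \<open>row_inv\<close>, \<open>Z\<close>
  the columns of the inverse in cyclic order, \<open>T\<close> temporaries, \<open>U\<close> the constant \<open>-1\<close>; \<open>O\<close> is never
  assigned and thus \<open>0\<close>.
\<close>

definition norm_prog :: prog where
  "norm_prog = For ''c'' (Var ''n'') (Seq
     (For ''t'' (Var ''m'')
       (FOp FDiv (Loc ''L'' (Var ''c'') (Var ''t''))
         (Loc ''x'' (Plus (Var ''t'') (Num 1)) (Plus (Var ''c'') (Num 1)))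
         (Loc ''x'' (Var ''k'') (Plus (Var ''c'') (Num 1)))))
     (FOp FDiv (Loc ''B'' (Var ''c'') (Num 0)) (Loc ''U'' (Num 0) (Num 0))
       (Loc ''x'' (Var ''k'') (Plus (Var ''c'') (Num 1)))))"

definition elim_step :: prog where
  "elim_step = For ''t'' (Var ''m'')
     (Seq (FOp FMul (Loc ''T'' (Num 0) (Num 0)) (Loc ''A'' (Var ''q'') (Plus (Var ''c'') (Var ''m'')))
            (Loc ''L'' (Var ''c'') (Var ''t'')))
          (FOp FSub (Loc ''A'' (Var ''q'') (Plus (Var ''c'') (Var ''t'')))
            (Loc ''A'' (Var ''q'') (Plus (Var ''c'') (Var ''t''))) (Loc ''T'' (Num 0) (Num 0))))"

text \<open>Equations have to be used from the last to the first, whereas \<open>For\<close> counts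
  upwards; hence the index \<open>n - 1 - d\<close>.\<close>

definition elim_row :: prog where
  "elim_row = For ''d'' (Var ''n'')
     (Seq (ISet ''c'' (Minus (Minus (Var ''n'') (Num 1)) (Var ''d'')))
     (Seq (FOp FMul (Loc ''A'' (Var ''q'') (Plus (Plus (Var ''n'') (Var ''m'')) (Var ''c'')))
            (Loc ''A'' (Var ''q'') (Plus (Var ''c'') (Var ''m''))) (Loc ''B'' (Var ''c'') (Num 0)))
          elim_step))"

text \<open>Adding the zero in \<open>O\<close> copies a field element at no cost, here and below.
  All other entries of \<open>A\<close> are already zero in the input state.\<close>

definition elim_prog :: prog where
  "elim_prog = For ''q'' (Var ''m'')
     (Seq (FOne (Loc ''A'' (Var ''q'') (Var ''q'')))
     (Seq (FOp FAdd (Loc ''A'' (Var ''q'') (Plus (Var ''n'') (Var ''q''))) (Loc ''U'' (Num 0) (Num 0)) (Loc ''O'' (Num 0) (Num 0)))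
          elim_row))"

definition width :: iexp where
  "width = Plus (Plus (Var ''n'') (Var ''m'')) (Var ''n'')"

text \<open>
  Instead of swapping rows, add later rows to the pivot row until the pivot is nonzero; additions
  are free. All row operations also run over the garbage columns between \<open>m\<close> and \<open>n + m\<close>.
\<close>

definition pivot_prog :: prog where
  "pivot_prog = For ''r'' (Var ''m'')
     (IfLess (Var ''p'') (Var ''r'')
       (IfZero (Loc ''A'' (Var ''p'') (Var ''p''))
         (For ''j'' width
           (FOp FAdd (Loc ''A'' (Var ''p'') (Var ''j'')) (Loc ''A'' (Var ''p'') (Var ''j''))
             (Loc ''A'' (Var ''r'') (Var ''j''))))
         Skip)
       Skip)"

text \<open>The pivot is saved in \<open>T\<close> first, because the loop overwrites it with 1
  before the end of the row is reached.\<close>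

definition scale_prog :: prog where
  "scale_prog = Seq (FOp FAdd (Loc ''T'' (Num 0) (Num 0)) (Loc ''A'' (Var ''p'') (Var ''p'')) (Loc ''O'' (Num 0) (Num 0)))
     (For ''j'' width
       (FOp FDiv (Loc ''A'' (Var ''p'') (Var ''j'')) (Loc ''A'' (Var ''p'') (Var ''j''))
         (Loc ''T'' (Num 0) (Num 0))))"

definition subtract_row :: prog where
  "subtract_row = For ''j'' width
     (Seq (FOp FMul (Loc ''T'' (Num 0) (Num 1)) (Loc ''T'' (Num 0) (Num 0)) (Loc ''A'' (Var ''p'') (Var ''j'')))
          (FOp FSub (Loc ''A'' (Var ''r'') (Var ''j'')) (Loc ''A'' (Var ''r'') (Var ''j''))
            (Loc ''T'' (Num 0) (Num 1))))"

text \<open>With truncated subtraction the tested sum is the distance of \<open>r\<close> and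
  \<open>p\<close>, so the test means that they differ. The multiplier is saved in \<open>T\<close>
  since its own cell is cleared on the way.\<close>

definition reduce_prog :: prog where
  "reduce_prog = For ''r'' (Var ''m'')
     (IfLess (Num 0) (Plus (Minus (Var ''r'') (Var ''p'')) (Minus (Var ''p'') (Var ''r'')))
       (Seq (FOp FAdd (Loc ''T'' (Num 0) (Num 0)) (Loc ''A'' (Var ''r'') (Var ''p'')) (Loc ''O'' (Num 0) (Num 0)))
            subtract_row)
       Skip)"

definition gauss_prog :: prog where
  "gauss_prog = For ''p'' (Var ''m'') (Seq pivot_prog (Seq scale_prog reduce_prog))"

definition dot_prog :: prog where
  "dot_prog = For ''t'' (Var ''m'')
     (Seq (FOp FMul (Loc ''T'' (Num 0) (Num 1)) (Loc ''L'' (Minus (Var ''j'') (Var ''m'')) (Var ''t''))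
            (Loc ''Z'' (Plus (Minus (Var ''j'') (Var ''m'')) (Var ''t'')) (Var ''c'')))
          (FOp FAdd (Loc ''T'' (Num 0) (Num 0)) (Loc ''T'' (Num 0) (Num 0)) (Loc ''T'' (Num 0) (Num 1))))"

text \<open>The right-hand side is a unit vector, so its contribution is \<open>B c\<close> in
  equation \<open>c\<close> and nothing elsewhere: a comparison of \<open>j - m\<close> with
  \<open>c\<close> and a free addition replace a multiplication. This keeps the cost of an entry at
  \<open>m\<close>.\<close>

definition finish_cell :: prog where
  "finish_cell = Seq (IfLess (Plus (Minus (Minus (Var ''j'') (Var ''m'')) (Var ''c''))
                 (Minus (Var ''c'') (Minus (Var ''j'') (Var ''m'')))) (Num 1)
       (FOp FAdd (Loc ''T'' (Num 0) (Num 0)) (Loc ''T'' (Num 0) (Num 0)) (Loc ''B'' (Var ''c'') (Num 0)))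
       Skip)
     (FOp FSub (Loc ''Z'' (Var ''j'') (Var ''c'')) (Loc ''O'' (Num 0) (Num 0)) (Loc ''T'' (Num 0) (Num 0)))"

definition cell_prog :: prog where
  "cell_prog = IfLess (Var ''j'') (Var ''m'')
     (FOp FAdd (Loc ''Z'' (Var ''j'') (Var ''c''))
       (Loc ''A'' (Var ''j'') (Plus (Plus (Var ''n'') (Var ''m'')) (Var ''c''))) (Loc ''O'' (Num 0) (Num 0)))
     (Seq (FZero (Loc ''T'' (Num 0) (Num 0)))
     (Seq dot_prog
     finish_cell))"

text \<open>The row index turns cyclic order into the order of the matrix. The summand
  \<open>n\<close> prevents truncation when \<open>i\<close> is subtracted.\<close>

definition solve_prog :: prog where
  "solve_prog = For ''c'' (Var ''n'') (For ''j'' (Var ''n'') (Seq cell_prog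
     (FOp FAdd (Loc ''inv'' (Plus (Rem (Minus (Plus (Plus (Var ''j'') (Num 1)) (Var ''n'')) (Var ''i'')) (Var ''n'')) (Num 1))
                  (Plus (Var ''c'') (Num 1)))
       (Loc ''Z'' (Var ''j'') (Var ''c'')) (Loc ''O'' (Num 0) (Num 0)))))"

section \<open>Correctness and cost of the subprograms\<close>

context ring_field
begin

lemma wp_norm_prog:
  assumes cl: "closed_state F st"
    and v: "ivar st ''n'' = n" "ivar st ''m'' = m" "ivar st ''k'' = k"
    and nz: "\<And>c. c < n \<Longrightarrow> arr st ''x'' k (Suc c) \<noteq> \<zero>"
  shows "wp F norm_prog (\<lambda>s.
      (\<forall>c<n. (\<forall>t<m. arr s ''L'' c t = arr st ''x'' (Suc t) (Suc c) \<otimes> inv (arr st ''x'' k (Suc c)))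
        \<and> arr s ''B'' c 0 = arr st ''U'' 0 0 \<otimes> inv (arr st ''x'' k (Suc c)))
      \<and> cost s \<le> cost st + n * (m + 1)) st"
  unfolding norm_prog_def
proof (rule wp_For[OF field_axioms cl, where N = n and w = "m + 1" and I = "\<lambda>j s. \<forall>c<j.
      (\<forall>t<m. arr s ''L'' c t = arr st ''x'' (Suc t) (Suc c) \<otimes> inv (arr st ''x'' k (Suc c)))
        \<and> arr s ''B'' c 0 = arr st ''U'' 0 0 \<otimes> inv (arr st ''x'' k (Suc c))"], goal_cases)
  case (3 c s)
  have s: "ivar s ''n'' = n" "ivar s ''m'' = m" "ivar s ''k'' = k" "arr s ''x'' = arr st ''x''"
    "arr s ''U'' = arr st ''U''"
    using 3(3) v by (simp_all add: unchanged_def)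
  have cl': "closed_state F (iput ''c'' c s)" using 3(4) by simp
  show ?case
    unfolding wp_simps(2)
  proof (rule wp_For[OF field_axioms cl', where N = m and w = 1 and I = "\<lambda>j s'.
      (\<forall>t<j. arr s' ''L'' c t = arr st ''x'' (Suc t) (Suc c) \<otimes> inv (arr st ''x'' k (Suc c)))
      \<and> (\<forall>c'. c' \<noteq> c \<longrightarrow> arr s' ''L'' c' = arr s ''L'' c')"], goal_cases)
    case (3 t s')
    then show ?case
      using s nz[OF \<open>c < n\<close>] by (auto simp: unchanged_def less_Suc_eq)
  next
    case (4 s')
    then show ?case
      using s nz[OF \<open>c < n\<close>] \<open>\<forall>c'<c. _ c'\<close> by (auto simp: unchanged_def less_Suc_eq)
  qed (use s in auto)
qed (use v in auto)

text \<open>The multiplier at position \<open>c + m\<close> lies just outside the range that is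
  updated and so stays constant during the loop.\<close>

lemma wp_elim_step:
  assumes cl: "closed_state F st"
    and v: "ivar st ''m'' = m" "ivar st ''q'' = q" "ivar st ''c'' = c"
  shows "wp F elim_step (\<lambda>s.
      (\<forall>p l. arr s ''A'' p l = (if p = q \<and> c \<le> l \<and> l < c + m
         then arr st ''A'' p l \<ominus> arr st ''A'' q (c + m) \<otimes> arr st ''L'' c (l - c) else arr st ''A'' p l))
      \<and> cost s \<le> cost st + m) st"
  unfolding elim_step_def
proof (rule wp_For[OF field_axioms cl, where N = m and w = 1 and I = "\<lambda>j s.
      \<forall>p l. arr s ''A'' p l = (if p = q \<and> c \<le> l \<and> l < c + j
         then arr st ''A'' p l \<ominus> arr st ''A'' q (c + m) \<otimes> arr st ''L'' c (l - c) else arr st ''A'' p l)"], goal_cases)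
  case (3 t s)
  have s: "ivar s ''m'' = m" "ivar s ''q'' = q" "ivar s ''c'' = c" "arr s ''L'' = arr st ''L''"
    using 3(3) v by (simp_all add: unchanged_def)
  show ?case
    using 3(1,2) s by (auto simp: less_Suc_eq)
qed (use v in auto)

lemma wp_elim_row:
  assumes cl: "closed_state F st"
    and v: "ivar st ''n'' = n" "ivar st ''m'' = m" "ivar st ''q'' = q"
    and inv: "row_inv n m (arr st ''L'') (\<lambda>c. arr st ''B'' c 0) q n (arr st ''A'' q)"
  shows "wp F elim_row (\<lambda>s.
      row_inv n m (arr st ''L'') (\<lambda>c. arr st ''B'' c 0) q 0 (arr s ''A'' q)
      \<and> (\<forall>p. p \<noteq> q \<longrightarrow> arr s ''A'' p = arr st ''A'' p)
      \<and> cost s \<le> cost st + n * (m + 1)) st"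
  unfolding elim_row_def
\<comment> \<open>After \<open>j\<close> iterations the last \<open>j\<close> equations are used up,
  so the boundary in \<open>row_inv\<close> is \<open>n - j\<close>.\<close>
proof (rule wp_For[OF field_axioms cl, where N = n and w = "m + 1" and I = "\<lambda>j s.
      row_inv n m (arr st ''L'') (\<lambda>c. arr st ''B'' c 0) q (n - j) (arr s ''A'' q)
      \<and> (\<forall>p. p \<noteq> q \<longrightarrow> arr s ''A'' p = arr st ''A'' p)"], goal_cases)
  case (3 d s)
  have s: "ivar s ''n'' = n" "ivar s ''m'' = m" "ivar s ''q'' = q" "arr s ''L'' = arr st ''L''"
    "arr s ''B'' = arr st ''B''"
    using 3(3) v by (simp_all add: unchanged_def elim_step_def)
  define c where "c = n - Suc d"
  have c: "n - d = Suc c" "n - Suc d = c" "c < n" "n - Suc 0 - d = c" using \<open>d < n\<close> by (auto simp: c_def)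
  define s1 where "s1 = iput ''c'' c (iput ''d'' d s)"
  define s2 where "s2 = fput (Loc ''A'' (Var ''q'') (Plus (Plus (Var ''n'') (Var ''m'')) (Var ''c'')))
    (arr s ''A'' q (c + m) \<otimes> arr st ''B'' c 0) (s1\<lparr>cost := Suc (cost s1)\<rparr>)"
  have cl2: "closed_state F s2"
    unfolding s2_def s1_def using closed_stateD[OF cl] closed_stateD[OF 3(4)] 3(4)
    by (intro closed_fput) simp_all
  have A2: "arr s2 ''A'' p l = (if p = q \<and> l = n + m + c then arr s ''A'' q (c + m) \<otimes> arr st ''B'' c 0
      else arr s ''A'' p l)" for p l
    by (simp add: s2_def s1_def s)
  have L2: "arr s2 ''L'' = arr st ''L''"
    by (simp add: s2_def s1_def s arr_fput_other)
  have "wp F elim_step (\<lambda>s'. (row_inv n m (arr st ''L'') (\<lambda>c. arr st ''B'' c 0) q (n - Suc d) (arr s' ''A'' q)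
      \<and> (\<forall>p. p \<noteq> q \<longrightarrow> arr s' ''A'' p = arr st ''A'' p)) \<and> cost s' \<le> cost s + (m + 1)) s2"
  proof (rule wp_mono[OF field_axioms cl2 wp_elim_step[OF cl2, of m q c]], goal_cases)
    case (4 s')
    then have A: "arr s' ''A'' p l = (if p = q \<and> c \<le> l \<and> l < c + m
         then arr s2 ''A'' p l \<ominus> arr s2 ''A'' q (c + m) \<otimes> arr s2 ''L'' c (l - c) else arr s2 ''A'' p l)" for p l
      by blast
    have "row_inv n m (arr st ''L'') (\<lambda>c. arr st ''B'' c 0) q c (arr s' ''A'' q)"
    proof (rule row_inv_step[where f = "arr s ''A'' q"])
      show "row_inv n m (arr st ''L'') (\<lambda>c. arr st ''B'' c 0) q (Suc c) (arr s ''A'' q)"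
        using 3(2) c by simp
    qed (use c closed_stateD[OF cl] closed_stateD[OF \<open>closed_state F s\<close>] closed_stateD[OF \<open>closed_state F s'\<close>]
        in \<open>auto simp: A A2 L2\<close>)
    moreover have "arr s' ''A'' p = arr st ''A'' p" if "p \<noteq> q" for p
      using 3(2) that by (simp add: A A2 fun_eq_iff)
    ultimately show ?case using 4(1) c by (simp add: s2_def s1_def)
  qed (use s in \<open>simp_all add: s2_def s1_def\<close>)
  then show ?case by (simp add: s c s1_def s2_def)
qed (use v inv in auto)

lemma wp_elim_prog:
  assumes cl: "closed_state F st"
    and v: "ivar st ''n'' = n" "ivar st ''m'' = m" and "m < n"
    and U: "arr st ''U'' 0 0 = \<ominus> \<one>" and Z: "arr st ''O'' 0 0 = \<zero>"
    and A: "\<And>q l. arr st ''A'' q l = \<zero>"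
  shows "wp F elim_prog (\<lambda>s.
      (\<forall>q<m. row_inv n m (arr st ''L'') (\<lambda>c. arr st ''B'' c 0) q 0 (arr s ''A'' q))
      \<and> cost s \<le> cost st + m * (n * (m + 1))) st"
  unfolding elim_prog_def
\<comment> \<open>The rows still to be treated must be known to be zero, since only two entries of
  each are set explicitly.\<close>
proof (rule wp_For[OF field_axioms cl, where N = m and w = "n * (m + 1)" and I = "\<lambda>j s.
      (\<forall>q<j. row_inv n m (arr st ''L'') (\<lambda>c. arr st ''B'' c 0) q 0 (arr s ''A'' q))
      \<and> (\<forall>q\<ge>j. \<forall>l. arr s ''A'' q l = \<zero>)"], goal_cases)
  case (3 q s)
  have s: "ivar s ''n'' = n" "ivar s ''m'' = m" "arr s ''L'' = arr st ''L''"
    "arr s ''B'' = arr st ''B''" "arr s ''U'' = arr st ''U''" "arr s ''O'' = arr st ''O''"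
    using 3(3) v by (simp_all add: unchanged_def elim_row_def elim_step_def)
  define s1 where "s1 = fput (Loc ''A'' (Var ''q'') (Var ''q'')) \<one> (iput ''q'' q s)"
  define s2 where "s2 = fput (Loc ''A'' (Var ''q'') (Plus (Var ''n'') (Var ''q''))) (\<ominus> \<one>) s1"
  have cl2: "closed_state F s2"
    unfolding s2_def s1_def using 3(4) by (intro closed_fput) simp_all
  have A2: "arr s2 ''A'' p l = (if p = q \<and> l = n + q then \<ominus> \<one> else if p = q \<and> l = q then \<one>
      else arr s ''A'' p l)" for p l
    by (simp add: s2_def s1_def s)
  have o2: "arr s2 ''L'' = arr st ''L''" "arr s2 ''B'' = arr st ''B''"
    by (simp_all add: s2_def s1_def s arr_fput_other)
  have "wp F elim_row (\<lambda>s'. ((\<forall>q'<Suc q. row_inv n m (arr st ''L'') (\<lambda>c. arr st ''B'' c 0) q' 0 (arr s' ''A'' q'))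
      \<and> (\<forall>q'\<ge>Suc q. \<forall>l. arr s' ''A'' q' l = \<zero>)) \<and> cost s' \<le> cost s + n * (m + 1)) s2"
  proof (rule wp_mono[OF field_axioms cl2 wp_elim_row[OF cl2, of n m q]], goal_cases)
    case 4
    show ?case
      unfolding o2
      by (rule row_inv_init) (use 3 \<open>m < n\<close> in \<open>auto simp: A2\<close>)
  next
    case (5 s')
    have "arr s2 ''A'' p = arr s ''A'' p" if "p \<noteq> q" for p
      using that by (simp add: A2 fun_eq_iff)
    then show ?case
      using 3(2) 5(1) by (auto simp: less_Suc_eq o2 s2_def[THEN arg_cong[of _ _ cost]] s1_def)
  qed (use s in \<open>simp_all add: s2_def s1_def\<close>)
  then show ?case using U Z by (simp add: s s1_def s2_def)
qed (use v A in auto)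


text \<open>As long as the pivot is zero, adding row \<open>r\<close> leaves it zero only if row
  \<open>r\<close> vanishes in column \<open>p\<close> as well; once nonzero, it is not touched
  again. A zero pivot at the end would thus contradict \<open>pivot_exists\<close>. The unit columns
  survive because rows \<open>p\<close> and \<open>r > p\<close> are both zero there.\<close>

lemma wp_pivot_prog:
  fixes n m :: nat
  defines "D \<equiv> n + m + n"
  assumes cl: "closed_state F st"
    and v: "ivar st ''n'' = n" "ivar st ''m'' = m" "ivar st ''p'' = p" and p: "p < m"
    and def: "trivial_kernel D m (arr st ''A'')"
    and unit: "\<And>r l. r < m \<Longrightarrow> l < p \<Longrightarrow> arr st ''A'' r l = (if r = l then \<one> else \<zero>)"
  shows "wp F pivot_prog (\<lambda>s. kern D m (arr s ''A'') = kern D m (arr st ''A'')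
      \<and> (\<forall>r<m. \<forall>l<p. arr s ''A'' r l = (if r = l then \<one> else \<zero>))
      \<and> arr s ''A'' p p \<noteq> \<zero> \<and> cost s \<le> cost st) st"
  unfolding pivot_prog_def
proof (rule wp_For[OF field_axioms cl, where N = m and w = 0 and I = "\<lambda>j s.
      kern D m (arr s ''A'') = kern D m (arr st ''A'')
      \<and> (\<forall>r<m. \<forall>l<p. arr s ''A'' r l = (if r = l then \<one> else \<zero>))
      \<and> (arr s ''A'' p p \<noteq> \<zero> \<or> (\<forall>r. p < r \<and> r < j \<longrightarrow> arr s ''A'' r p = \<zero>))"], goal_cases)
  case (3 r s)
  have s: "ivar s ''n'' = n" "ivar s ''m'' = m" "ivar s ''p'' = p"
    using 3(3) v by (simp_all add: unchanged_def)
  show ?case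
  proof (cases "p < r \<and> arr s ''A'' p p = \<zero>")
    case False
    then show ?thesis using 3(2) s by (auto simp: less_Suc_eq)
  next
    case True
    have cl1: "closed_state F (iput ''r'' r s)" using 3(4) by simp
    have "wp F (For ''j'' width
           (FOp FAdd (Loc ''A'' (Var ''p'') (Var ''j'')) (Loc ''A'' (Var ''p'') (Var ''j''))
             (Loc ''A'' (Var ''r'') (Var ''j'')))) (\<lambda>s'.
        (kern D m (arr s' ''A'') = kern D m (arr st ''A'')
      \<and> (\<forall>r<m. \<forall>l<p. arr s' ''A'' r l = (if r = l then \<one> else \<zero>))
      \<and> (arr s' ''A'' p p \<noteq> \<zero> \<or> (\<forall>r'. p < r' \<and> r' < Suc r \<longrightarrow> arr s' ''A'' r' p = \<zero>)))
      \<and> cost s' \<le> cost s + 0) (iput ''r'' r s)"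
    proof (rule wp_For[OF field_axioms cl1, where N = D and w = 0 and I = "\<lambda>j s'. \<forall>q l. arr s' ''A'' q l =
        (if q = p \<and> l < j then arr s ''A'' p l \<oplus> arr s ''A'' r l else arr s ''A'' q l)"], goal_cases)
      case (3 j s')
      have s': "ivar s' ''p'' = p" "ivar s' ''r'' = r" using 3(3) s by (simp_all add: unchanged_def)
      show ?case using 3(1,2) s' True by (auto simp: less_Suc_eq)
    next
      case (4 s')
      then have A: "arr s' ''A'' q l =
        (if q = p \<and> l < D then arr s ''A'' p l \<oplus> arr s ''A'' r l else arr s ''A'' q l)" for q l by blast
      have "kern D m (arr s' ''A'') = kern D m (arr s ''A'')"
        by (rule kern_add_row[of _ \<one> p r])
          (use True \<open>r < m\<close> closed_stateD[OF \<open>closed_state F s\<close>] in \<open>auto simp: A\<close>)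
      moreover have "arr s' ''A'' q l = (if q = l then \<one> else \<zero>)" if "q < m" "l < p" for q l
        using \<open>_ \<and> _ \<and> _\<close> that True \<open>r < m\<close> p by (auto simp: A)
      moreover have "arr s' ''A'' p p \<noteq> \<zero> \<or> (\<forall>r'. p < r' \<and> r' < Suc r \<longrightarrow> arr s' ''A'' r' p = \<zero>)"
        using \<open>_ \<and> _ \<and> _\<close> True p closed_stateD[OF \<open>closed_state F s\<close>]
        by (auto simp: A D_def less_Suc_eq)
      ultimately show ?case using \<open>_ \<and> _ \<and> _\<close> 4(4) by simp
    qed (use s in \<open>auto simp: width_def D_def\<close>)
    then show ?thesis using True s by simp
  qed
next
  case (4 s)
  have "arr s ''A'' p p \<noteq> \<zero>"
  proof
    assume z: "arr s ''A'' p p = \<zero>"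
    have "trivial_kernel D m (arr s ''A'')" using def 4(1) by (simp add: trivial_kernel_def)
    then obtain r where "p \<le> r" "r < m" "arr s ''A'' r p \<noteq> \<zero>"
      using pivot_exists[of "arr s ''A''" D m p] closed_stateD[OF 4(3)] p 4(1) by (auto simp: D_def)
    with 4(1) z show False by (cases "r = p") auto
  qed
  then show ?case using 4 by simp
qed (use v unit in auto)

lemma wp_scale_prog:
  fixes n m :: nat
  defines "D \<equiv> n + m + n"
  assumes cl: "closed_state F st"
    and v: "ivar st ''n'' = n" "ivar st ''m'' = m" "ivar st ''p'' = p" and p: "p < m"
    and Z: "arr st ''O'' 0 0 = \<zero>" and piv: "arr st ''A'' p p \<noteq> \<zero>"
    and unit: "\<And>r l. r < m \<Longrightarrow> l < p \<Longrightarrow> arr st ''A'' r l = (if r = l then \<one> else \<zero>)"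
  shows "wp F scale_prog (\<lambda>s. kern D m (arr s ''A'') = kern D m (arr st ''A'')
      \<and> (\<forall>r<m. \<forall>l<p. arr s ''A'' r l = (if r = l then \<one> else \<zero>))
      \<and> arr s ''A'' p p = \<one> \<and> cost s \<le> cost st + D) st"
proof -
  define h where "h = arr st ''A'' p p"
  have h: "h \<in> carrier F" "h \<noteq> \<zero>" using cl piv by (simp_all add: h_def closed_stateD)
  define s where "s = fput (Loc ''T'' (Num 0) (Num 0)) h st"
  have cls: "closed_state F s" unfolding s_def using cl h by (intro closed_fput)
  have As: "arr s ''A'' = arr st ''A''" by (simp add: s_def arr_fput_other)
  have "wp F (For ''j'' width
       (FOp FDiv (Loc ''A'' (Var ''p'') (Var ''j'')) (Loc ''A'' (Var ''p'') (Var ''j''))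
         (Loc ''T'' (Num 0) (Num 0)))) (\<lambda>s. kern D m (arr s ''A'') = kern D m (arr st ''A'')
      \<and> (\<forall>r<m. \<forall>l<p. arr s ''A'' r l = (if r = l then \<one> else \<zero>))
      \<and> arr s ''A'' p p = \<one> \<and> cost s \<le> cost st + D) s"
  proof (rule wp_For[OF field_axioms cls, where N = D and w = 1 and I = "\<lambda>j s'. \<forall>q l. arr s' ''A'' q l =
        (if q = p \<and> l < j then arr st ''A'' p l \<otimes> inv h else arr st ''A'' q l)"], goal_cases)
    case (3 j s')
    have s': "ivar s' ''p'' = p" "arr s' ''T'' 0 0 = h" using 3(3) v by (simp_all add: unchanged_def s_def)
    show ?case using 3(1,2) s' h by (auto simp: less_Suc_eq)
  next
    case (4 s')
    then have A: "arr s' ''A'' q l =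
        (if q = p \<and> l < D then arr st ''A'' p l \<otimes> inv h else arr st ''A'' q l)" for q l by blast
    have "inv h \<noteq> \<zero>" using h by (metis Units_r_inv field_Units r_null zero_not_one Diff_iff singletonD)
    then have "kern D m (arr s' ''A'') = kern D m (arr st ''A'')"
      by (intro kern_scale_row[of _ "inv h" D _ p]) (use h closed_stateD[OF cl] in \<open>auto simp: A\<close>)
    moreover have "arr s' ''A'' q l = (if q = l then \<one> else \<zero>)" if "q < m" "l < p" for q l
      using that unit h by (auto simp: A)
    moreover have "arr s' ''A'' p p = \<one>"
      using p h field_Units by (simp add: A D_def h_def[symmetric])
    ultimately show ?case using 4(4) by (simp add: s_def)
  qed (use v As in \<open>auto simp: width_def D_def s_def\<close>)
  then show ?thesis
    using v Z h by (simp add: scale_prog_def h_def[symmetric] s_def)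
qed

lemma wp_subtract_row:
  fixes n m :: nat
  defines "D \<equiv> n + m + n"
  assumes cl: "closed_state F st"
    and v: "ivar st ''n'' = n" "ivar st ''m'' = m" "ivar st ''p'' = p" "ivar st ''r'' = r" and "p \<noteq> r"
  shows "wp F subtract_row (\<lambda>s. (\<forall>q l. arr s ''A'' q l = (if q = r \<and> l < D
        then arr st ''A'' r l \<ominus> arr st ''T'' 0 0 \<otimes> arr st ''A'' p l else arr st ''A'' q l))
      \<and> cost s \<le> cost st + D) st"
  unfolding subtract_row_def
proof (rule wp_For[OF field_axioms cl, where N = D and w = 1 and I = "\<lambda>j s.
      (\<forall>q l. arr s ''A'' q l = (if q = r \<and> l < j
        then arr st ''A'' r l \<ominus> arr st ''T'' 0 0 \<otimes> arr st ''A'' p l else arr st ''A'' q l))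
      \<and> arr s ''T'' 0 0 = arr st ''T'' 0 0"], goal_cases)
  case (3 j s)
  have s: "ivar s ''p'' = p" "ivar s ''r'' = r" using 3(3) v by (simp_all add: unchanged_def)
  show ?case using 3(1,2) s \<open>p \<noteq> r\<close> by (auto simp: less_Suc_eq)
qed (use v in \<open>auto simp: width_def D_def\<close>)

text \<open>Row \<open>p\<close> is zero in the earlier unit columns and 1 at the pivot, so
  subtracting its multiples clears column \<open>p\<close> and preserves the columns before
  it.\<close>

lemma wp_reduce_prog:
  fixes n m :: nat
  defines "D \<equiv> n + m + n"
  assumes cl: "closed_state F st"
    and v: "ivar st ''n'' = n" "ivar st ''m'' = m" "ivar st ''p'' = p" and p: "p < m"
    and Z: "arr st ''O'' 0 0 = \<zero>" and piv: "arr st ''A'' p p = \<one>"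
    and unit: "\<And>r l. r < m \<Longrightarrow> l < p \<Longrightarrow> arr st ''A'' r l = (if r = l then \<one> else \<zero>)"
  shows "wp F reduce_prog (\<lambda>s. kern D m (arr s ''A'') = kern D m (arr st ''A'')
      \<and> (\<forall>r<m. \<forall>l<Suc p. arr s ''A'' r l = (if r = l then \<one> else \<zero>))
      \<and> cost s \<le> cost st + m * D) st"
  unfolding reduce_prog_def
proof (rule wp_For[OF field_axioms cl, where N = m and w = D and I = "\<lambda>j s.
      kern D m (arr s ''A'') = kern D m (arr st ''A'')
      \<and> (\<forall>r<m. \<forall>l<p. arr s ''A'' r l = (if r = l then \<one> else \<zero>))
      \<and> arr s ''A'' p p = \<one> \<and> (\<forall>r<j. r \<noteq> p \<longrightarrow> arr s ''A'' r p = \<zero>)"], goal_cases)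
  case (3 r s)
  have s: "ivar s ''n'' = n" "ivar s ''m'' = m" "ivar s ''p'' = p" "arr s ''O'' 0 0 = \<zero>"
    using 3(3) v Z by (simp_all add: unchanged_def subtract_row_def)
  show ?case
  proof (cases "r = p")
    case True
    then show ?thesis using 3(2) s by (auto simp: less_Suc_eq)
  next
    case False
    define h where "h = arr s ''A'' r p"
    have h: "h \<in> carrier F" using 3(4) by (simp add: h_def closed_stateD)
    define s1 where "s1 = fput (Loc ''T'' (Num 0) (Num 0)) h (iput ''r'' r s)"
    have cl1: "closed_state F s1" unfolding s1_def using 3(4) h by (intro closed_fput) simp_all
    have A1: "arr s1 ''A'' = arr s ''A''" by (simp add: s1_def arr_fput_other)
    have T1: "arr s1 ''T'' 0 0 = h" by (simp add: s1_def)
    have "wp F subtract_row (\<lambda>s'. (kern D m (arr s' ''A'') = kern D m (arr st ''A'')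
      \<and> (\<forall>r<m. \<forall>l<p. arr s' ''A'' r l = (if r = l then \<one> else \<zero>))
      \<and> arr s' ''A'' p p = \<one> \<and> (\<forall>r'<Suc r. r' \<noteq> p \<longrightarrow> arr s' ''A'' r' p = \<zero>)) \<and> cost s' \<le> cost s + D) s1"
    proof (rule wp_mono[OF field_axioms cl1 wp_subtract_row[OF cl1, of n m p r]], goal_cases)
      case (6 s')
      then have A: "arr s' ''A'' q l = (if q = r \<and> l < D
        then arr s ''A'' r l \<ominus> h \<otimes> arr s ''A'' p l else arr s ''A'' q l)" for q l
        by (simp add: A1 T1 D_def)
      have "kern D m (arr s' ''A'') = kern D m (arr s ''A'')"
        by (rule kern_add_row[of _ "\<ominus> h" r p])
          (use False p h closed_stateD[OF \<open>closed_state F s\<close>] in \<open>auto simp: A a_minus_def l_minus\<close>)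
      moreover have "arr s' ''A'' q l = (if q = l then \<one> else \<zero>)" if "q < m" "l < p" for q l
        using 3(2) that False p h by (auto simp: A a_minus_def)
      moreover have "arr s' ''A'' p p = \<one>" using 3(2) False by (simp add: A)
      moreover have "arr s' ''A'' r' p = \<zero>" if "r' < Suc r" "r' \<noteq> p" for r'
        using 3(2) that p h by (auto simp: A D_def less_Suc_eq h_def[symmetric] a_minus_def r_neg)
      ultimately show ?case using 3(2) 6(1) by (simp add: s1_def D_def)
    qed (use s False in \<open>simp_all add: s1_def\<close>)
    moreover have "p < r \<or> r < p" using False by linarith
    ultimately show ?thesis using s h by (elim disjE) (simp_all add: s1_def h_def[symmetric])
  qed
qed (use v piv unit p in \<open>auto simp: less_Suc_eq\<close>)

lemma wp_gauss_prog:
  fixes n m :: nat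
  defines "D \<equiv> n + m + n"
  assumes cl: "closed_state F st"
    and v: "ivar st ''n'' = n" "ivar st ''m'' = m"
    and Z: "arr st ''O'' 0 0 = \<zero>" and def: "trivial_kernel D m (arr st ''A'')"
  shows "wp F gauss_prog (\<lambda>s. kern D m (arr s ''A'') = kern D m (arr st ''A'')
      \<and> (\<forall>r<m. \<forall>l<m. arr s ''A'' r l = (if r = l then \<one> else \<zero>))
      \<and> cost s \<le> cost st + m * (D + m * D)) st"
  unfolding gauss_prog_def
proof (rule wp_For[OF field_axioms cl, where N = m and w = "D + m * D" and I = "\<lambda>j s.
      kern D m (arr s ''A'') = kern D m (arr st ''A'')
      \<and> (\<forall>r<m. \<forall>l<j. arr s ''A'' r l = (if r = l then \<one> else \<zero>))"], goal_cases)
  case (3 p s)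
  have s: "ivar s ''n'' = n" "ivar s ''m'' = m" "arr s ''O'' 0 0 = \<zero>"
    using 3(3) v Z by (simp_all add: unchanged_def pivot_prog_def scale_prog_def reduce_prog_def subtract_row_def)
  note I = 3(2)
  define s1 where "s1 = iput ''p'' p s"
  have s1: "ivar s1 ''n'' = n" "ivar s1 ''m'' = m" "ivar s1 ''p'' = p" "arr s1 = arr s" "cost s1 = cost s"
    using s by (simp_all add: s1_def)
  have cl1: "closed_state F s1" using 3(4) by (simp add: s1_def)
  \<comment> \<open>The kernel has not changed since the start, so nonsingularity is still available
    when this pivot is sought.\<close>
  have d1: "trivial_kernel (n + m + n) m (arr s1 ''A'')"
    using def 3(2) by (simp add: trivial_kernel_def s1 D_def)
  show ?case
    unfolding wp_simps(2) s1_def[symmetric]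
  proof (rule wp_mono[OF field_axioms cl1 wp_pivot_prog[OF cl1 s1(1-3) 3(1) d1]], goal_cases)
    case (1 r l)
    then show ?case using 3(2) s1 by simp
  next
    case (2 s2)
    have s2: "ivar s2 ''n'' = n" "ivar s2 ''m'' = m" "ivar s2 ''p'' = p" "arr s2 ''O'' 0 0 = \<zero>"
      using 2(2) s s1 by (simp_all add: unchanged_def pivot_prog_def)
    show ?case
    proof (rule wp_mono[OF field_axioms 2(3) wp_scale_prog[OF 2(3) s2(1-3) 3(1) s2(4)]], goal_cases)
      case (3 s3)
      have s3: "ivar s3 ''n'' = n" "ivar s3 ''m'' = m" "ivar s3 ''p'' = p" "arr s3 ''O'' 0 0 = \<zero>"
        using 3(2) s2 by (simp_all add: unchanged_def scale_prog_def)
      show ?case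
        by (rule wp_mono[OF field_axioms 3(3) wp_reduce_prog[OF 3(3) s3(1-3) \<open>p < m\<close> s3(4)]])
          (use 3(1) 2(1) I s1 in \<open>auto simp: D_def\<close>)
    qed (use 2(1) in auto)
  qed
qed (use v in auto)

section \<open>Recovery of the columns of the inverse by the recurrence\<close>

lemma wp_dot_prog:
  assumes cl: "closed_state F st"
    and v: "ivar st ''m'' = m" "ivar st ''j'' = m + e" "ivar st ''c'' = c"
    and T: "arr st ''T'' 0 0 = \<zero>"
  shows "wp F dot_prog (\<lambda>s. arr s ''T'' 0 0 = (\<Oplus>t\<in>{..<m}. arr st ''L'' e t \<otimes> arr st ''Z'' (e + t) c)
      \<and> cost s \<le> cost st + m) st"
  unfolding dot_prog_def
proof (rule wp_For[OF field_axioms cl, where N = m and w = 1 and I = "\<lambda>j s.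
      arr s ''T'' 0 0 = (\<Oplus>t\<in>{..<j}. arr st ''L'' e t \<otimes> arr st ''Z'' (e + t) c)"], goal_cases)
  case (3 t s)
  have s: "ivar s ''m'' = m" "ivar s ''j'' = m + e" "ivar s ''c'' = c" "arr s ''L'' = arr st ''L''"
    "arr s ''Z'' = arr st ''Z''"
    using 3(3) v by (simp_all add: unchanged_def)
  show ?case using 3(2) s closed_stateD[OF cl] by (simp add: lsum_Suc)
qed (use v T in auto)

text \<open>The first \<open>m\<close> entries are read off the reduced system; any later one is
  given by the normalized equation \<open>j - m\<close> in terms of its \<open>m\<close>
  predecessors.\<close>

lemma wp_cell_prog:
  assumes cl: "closed_state F st"
    and v: "ivar st ''n'' = n" "ivar st ''m'' = m" "ivar st ''j'' = j" "ivar st ''c'' = c"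
    and Z: "arr st ''O'' 0 0 = \<zero>" and j: "j < n" and c: "c < n"
    and init: "\<And>j. j < m \<Longrightarrow> arr st ''A'' j (n + m + c) = z j"
    and z: "solves n m (arr st ''L'') (\<lambda>c. arr st ''B'' c 0) z (\<lambda>c'. if c' = c then \<one> else \<zero>)"
    and prev: "\<And>l. l < j \<Longrightarrow> arr st ''Z'' l c = z l"
  shows "wp F cell_prog (\<lambda>s. arr s ''Z'' j c = z j
      \<and> (\<forall>l. l \<noteq> j \<longrightarrow> arr s ''Z'' l c = arr st ''Z'' l c) \<and> cost s \<le> cost st + m) st"
proof (cases "j < m")
  case True
  then show ?thesis
    using v Z init closed_stateD[OF cl] z by (simp add: cell_prog_def solves_def)
next
  case False
  define e where "e = j - m"
  have e: "j = m + e" "e < n" using False j by (auto simp: e_def)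
  define s where "s = fput (Loc ''T'' (Num 0) (Num 0)) \<zero> st"
  have s: "ivar s = ivar st" "arr s ''L'' = arr st ''L''" "arr s ''Z'' = arr st ''Z''"
    "arr s ''T'' 0 0 = \<zero>" "cost s = cost st"
    by (simp_all add: s_def arr_fput_other)
  have cls: "closed_state F s" unfolding s_def using cl by (intro closed_fput) simp_all
  define S where "S = (\<Oplus>t\<in>{..<m}. arr st ''L'' e t \<otimes> z (e + t))"
  have sum: "(\<Oplus>t\<in>{..<m}. arr st ''L'' e t \<otimes> arr st ''Z'' (e + t) c) =
      S"
    unfolding S_def using z closed_stateD[OF cl] prev e by (intro lsum_cong) (auto simp: solves_def)
  have S: "S \<in> carrier F"
    unfolding S_def using z closed_stateD[OF cl] by (intro finsum_closed) (auto simp: solves_def)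
  have "z (e + m) = \<ominus> (S \<oplus> arr st ''B'' e 0 \<otimes> (if e = c then \<one> else \<zero>))"
    using z e unfolding solves_def S_def by blast
  then have zj: "z j = \<ominus> (if e = c then S \<oplus> arr st ''B'' c 0 else S)"
    using S closed_stateD[OF cl] e by (auto simp: add.commute)
  have "wp F dot_prog (\<lambda>s'. arr s' ''T'' 0 0 = S \<and> unchanged {''t''} {''T''} s s' \<and> closed_state F s'
      \<and> cost s' \<le> cost st + m) s"
  proof (rule wp_mono[OF field_axioms cls wp_dot_prog[OF cls, of m e c]], goal_cases)
    case (5 s')
    then show ?case by (simp add: s sum dot_prog_def)
  qed (use v e s in simp_all)
  then have "wp F dot_prog (wp F finish_cell
      (\<lambda>s. arr s ''Z'' j c = z j \<and> (\<forall>l. l \<noteq> j \<longrightarrow> arr s ''Z'' l c = arr st ''Z'' l c)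
        \<and> cost s \<le> cost st + m)) s"
  proof (rule wp_mono[OF field_axioms cls])
    fix s' assume *: "arr s' ''T'' 0 0 = S \<and> unchanged {''t''} {''T''} s s' \<and> closed_state F s'
      \<and> cost s' \<le> cost st + m"
    then have s': "ivar s' ''m'' = m" "ivar s' ''j'' = m + e" "ivar s' ''c'' = c"
      "arr s' ''O'' 0 0 = \<zero>" "arr s' ''B'' = arr st ''B''" "arr s' ''Z'' = arr st ''Z''"
      using v Z e s by (simp_all add: unchanged_def s_def arr_fput_other)
    have "e - c + (c - e) < 1 \<longleftrightarrow> e = c" by auto
    then show "wp F finish_cell
      (\<lambda>s. arr s ''Z'' j c = z j \<and> (\<forall>l. l \<noteq> j \<longrightarrow> arr s ''Z'' l c = arr st ''Z'' l c)
        \<and> cost s \<le> cost st + m) s'"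
      using * s' S closed_stateD[OF cl] zj[unfolded e(1)] e(1) by (simp add: finish_cell_def a_minus_def)
  qed
  then show ?thesis
    unfolding cell_prog_def using False v by (simp add: s_def)
qed

text \<open>Each position of \<open>inv\<close> only ever receives the entry of \<open>N\<close> at
  that same position, so later writes cannot spoil earlier ones.\<close>

lemma wp_solve_prog:
  assumes cl: "closed_state F st"
    and v: "ivar st ''n'' = n" "ivar st ''m'' = m" "ivar st ''i'' = i"
    and Z: "arr st ''O'' 0 0 = \<zero>"
    and init: "\<And>c j. c < n \<Longrightarrow> j < m \<Longrightarrow> arr st ''A'' j (n + m + c) = z c j"
    and z: "\<And>c. c < n \<Longrightarrow> solves n m (arr st ''L'') (\<lambda>c. arr st ''B'' c 0) (z c) (\<lambda>c'. if c' = c then \<one> else \<zero>)"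
    and zN: "\<And>c j. c < n \<Longrightarrow> j < n \<Longrightarrow> z c j = N (Suc ((Suc j + n - i) mod n)) (Suc c)"
  shows "wp F solve_prog (\<lambda>s.
      (\<forall>c<n. \<forall>j<n. arr s ''inv'' (Suc ((Suc j + n - i) mod n)) (Suc c) = N (Suc ((Suc j + n - i) mod n)) (Suc c))
      \<and> cost s \<le> cost st + n * (n * m)) st"
  unfolding solve_prog_def
proof (rule wp_For[OF field_axioms cl, where N = n and w = "n * m" and I = "\<lambda>c s.
      (\<forall>c'<c. \<forall>j<n. arr s ''inv'' (Suc ((Suc j + n - i) mod n)) (Suc c') = N (Suc ((Suc j + n - i) mod n)) (Suc c'))"], goal_cases)
  case (3 c s)
  note I = 3(2)
  define B where "B = {''T'', ''Z'', ''inv''}"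
  define V where "V = {''c'', ''j'', ''t''}"
  have us: "unchanged V B st s"
    using 3(3) by (rule unchanged_mono) (auto simp: cell_prog_def dot_prog_def finish_cell_def B_def V_def)
  define s1 where "s1 = iput ''c'' c s"
  have cl1: "closed_state F s1" using 3(4) by (simp add: s1_def)
  show ?case
    unfolding s1_def[symmetric]
  proof (rule wp_For[OF field_axioms cl1, where N = n and w = m and I = "\<lambda>j s'.
      (\<forall>l<j. arr s' ''Z'' l c = z c l) \<and>
      (\<forall>l<j. arr s' ''inv'' (Suc ((Suc l + n - i) mod n)) (Suc c) = N (Suc ((Suc l + n - i) mod n)) (Suc c)) \<and>
      (\<forall>r c'. c' \<noteq> Suc c \<longrightarrow> arr s' ''inv'' r c' = arr s ''inv'' r c')"], goal_cases)
    case (3 j s')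
    have s': "ivar s' ''n'' = n" "ivar s' ''m'' = m" "ivar s' ''i'' = i" "ivar s' ''c'' = c"
      "arr s' ''O'' = arr st ''O''" "arr s' ''L'' = arr st ''L''" "arr s' ''B'' = arr st ''B''"
      "arr s' ''A'' = arr st ''A''"
      using 3(3) us v
      by (simp_all add: unchanged_def V_def B_def cell_prog_def dot_prog_def finish_cell_def s1_def)
    define s2 where "s2 = iput ''j'' j s'"
    have cl2: "closed_state F s2" using 3(4) by (simp add: s2_def)
    show ?case
      unfolding wp_simps(2) s2_def[symmetric]
    proof (rule wp_mono[OF field_axioms cl2 wp_cell_prog[OF cl2, of n m j c "z c"]], goal_cases)
      case (11 s3)
      have s3: "ivar s3 ''n'' = n" "ivar s3 ''j'' = j" "ivar s3 ''i'' = i" "ivar s3 ''c'' = c"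
        "arr s3 ''O'' 0 0 = \<zero>" "arr s3 ''inv'' = arr s' ''inv''"
        using 11(2) s' Z by (simp_all add: unchanged_def cell_prog_def dot_prog_def finish_cell_def s2_def)
      have "N (Suc ((Suc j + n - i) mod n)) (Suc c) \<in> carrier F"
        using z[OF \<open>c < n\<close>] zN[OF \<open>c < n\<close> \<open>j < n\<close>] by (metis solves_def)
      then show ?case
        using 11(1,3) 3(1,2) s3 zN[OF \<open>c < n\<close> \<open>j < n\<close>] closed_stateD[OF 11(3)]
        by (auto simp: less_Suc_eq s2_def)
    qed (use s' Z \<open>c < n\<close> \<open>j < n\<close> init z 3(2) in \<open>simp_all add: s2_def\<close>)
  next
    case (4 s')
    then show ?case using I by (auto simp: less_Suc_eq s1_def)
  qed (use us v in \<open>auto simp: unchanged_def V_def B_def s1_def\<close>)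
qed (use v in auto)

end

section \<open>Correctness for cyclic banded matrices\<close>

definition cbm_prog :: prog where
  "cbm_prog = Seq (ISet ''m'' (Minus (Var ''k'') (Num 1)))
    (Seq (FOne (Loc ''U'' (Num 0) (Num 0)))
    (Seq (FOp FSub (Loc ''U'' (Num 0) (Num 0)) (Loc ''O'' (Num 0) (Num 0)) (Loc ''U'' (Num 0) (Num 0)))
    (Seq norm_prog (Seq elim_prog (Seq gauss_prog solve_prog)))))"

lemma (in ring_field) finsum_swap:
  assumes "finite A" "finite B" "\<And>a b. a \<in> A \<Longrightarrow> b \<in> B \<Longrightarrow> f a b \<in> carrier F"
  shows "(\<Oplus>a\<in>A. \<Oplus>b\<in>B. f a b) = (\<Oplus>b\<in>B. \<Oplus>a\<in>A. f a b)"
  using assms(1,3)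
proof (induction A)
  case empty
  then show ?case by simp
next
  case (insert a A)
  have "(\<Oplus>a'\<in>insert a A. \<Oplus>b\<in>B. f a' b) = (\<Oplus>b\<in>B. f a b) \<oplus> (\<Oplus>b\<in>B. \<Oplus>a\<in>A. f a b)"
    using insert by (subst finsum_insert) (auto intro!: finsum_closed)
  also have "\<dots> = (\<Oplus>b\<in>B. f a b \<oplus> (\<Oplus>a\<in>A. f a b))"
    using insert by (intro finsum_addf[symmetric]) (auto intro!: finsum_closed)
  also have "\<dots> = (\<Oplus>b\<in>B. \<Oplus>a'\<in>insert a A. f a' b)"
    using insert by (intro finsum_cong') (auto intro!: finsum_closed)
  finally show ?case .
qed

lemma (in ring_field) eq_minus_iff:
  assumes "p \<in> carrier F" "s \<in> carrier F" "b \<in> carrier F"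
  shows "p = b \<ominus> s \<longleftrightarrow> s \<oplus> p = b"
proof
  assume "p = b \<ominus> s"
  moreover have "s \<oplus> (b \<ominus> s) = b \<oplus> (s \<oplus> \<ominus> s)"
    using assms by (simp add: a_minus_def a_ac)
  ultimately show "s \<oplus> p = b" using assms by (simp add: r_neg)
next
  assume "s \<oplus> p = b"
  moreover have "(s \<oplus> p) \<ominus> s = p \<oplus> (s \<oplus> \<ominus> s)"
    using assms by (simp add: a_minus_def a_ac)
  ultimately show "p = b \<ominus> s" using assms by (simp add: r_neg)
qed

section \<open>Cyclic order of the columns\<close>

locale cbm = ring_field F for F :: "'a ring" (structure) +
  fixes n m i :: nat and x M N :: "nat \<Rightarrow> nat \<Rightarrow> 'a"
  assumes m_less: "m < n"
    and cbm: "is_cbm F n (Suc m) i x M"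
    and inverse: "inverse_matrix F n M N"
begin

text \<open>Equation \<open>c\<close> (counted from 0) has the coefficient \<open>x (Suc t) (Suc c)\<close> at column \<open>idx (c + t)\<close>.\<close>

definition idx :: "nat \<Rightarrow> nat" where
  "idx j = Suc ((Suc j + n - i) mod n)"

lemma i_bounds: "1 \<le> i" "i \<le> Suc m" "i \<le> n"
  using cbm m_less by (auto simp: is_cbm_def)

lemma x_closed: "t < Suc m \<Longrightarrow> c < n \<Longrightarrow> x (Suc t) (Suc c) \<in> carrier F"
  using cbm by (auto simp: is_cbm_def)

lemma x_nonzero: "c < n \<Longrightarrow> x (Suc m) (Suc c) \<noteq> \<zero>"
  using cbm by (auto simp: is_cbm_def)

lemma idx_range: "idx j \<in> {1..n}"
  using m_less by (auto simp: idx_def Suc_le_eq)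

lemma idx_periodic: "idx (n + j) = idx j"
proof -
  have "Suc (n + j) + n - i = (Suc j + n - i) + n" using i_bounds by simp
  then show ?thesis unfolding idx_def by simp
qed

text \<open>The link to the description of the band in \<open>is_cbm\<close>; the natural
  subtraction in \<open>idx\<close> is exact because \<open>i \<le> n\<close>.\<close>

lemma idx_cong: "[int (idx (c + t)) = int (Suc c) + int (Suc t) - int i] (mod int n)"
proof -
  have "int (Suc (c + t) + n - i) = int c + int t + 1 + int n - int i" using i_bounds by simp
  then have "int (idx (c + t)) = (int c + int t + 1 + int n - int i) mod int n + 1"
    by (simp only: idx_def of_nat_Suc zmod_int add.commute)
  also have "[\<dots> = (int c + int t + 1 + int n - int i) + 1] (mod int n)"
    by (intro cong_add) (auto simp: cong_def)
  also have "[(int c + int t + 1 + int n - int i) + 1 = int (Suc c) + int (Suc t) - int i] (mod int n)"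
    by (simp add: cong_iff_dvd_diff)
  finally show ?thesis .
qed

lemma idx_inj: "inj_on (\<lambda>t. idx (c + t)) {..<n}"
proof (rule inj_onI)
  fix t t' assume t: "t \<in> {..<n}" "t' \<in> {..<n}" and "idx (c + t) = idx (c + t')"
  then have "[int (Suc c) + int (Suc t) - int i = int (Suc c) + int (Suc t') - int i] (mod int n)"
    using idx_cong[of c t] idx_cong[of c t'] by (metis cong_sym cong_trans)
  then have "[int t = int t'] (mod int n)"
    by (simp add: cong_iff_dvd_diff)
  then show "t = t'"
    using t by (simp add: cong_int_iff cong_less_modulus_unique_nat)
qed

lemma idx_image: "(\<lambda>t. idx (c + t)) ` {..<n} = {1..n}"
proof (rule card_subset_eq)
  show "(\<lambda>t. idx (c + t)) ` {..<n} \<subseteq> {1..n}" using idx_range by blast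
  show "card ((\<lambda>t. idx (c + t)) ` {..<n}) = card {1..n}" by (simp add: card_image[OF idx_inj])
qed simp

text \<open>As \<open>Suc m \<le> n\<close>, the shifts of the diagonals are distinct modulo
  \<open>n\<close>: the band does not overlap itself, and the positions after it are hit by no
  diagonal.\<close>

lemma M_band:
  assumes "c < n" "t < n"
  shows "M (Suc c) (idx (c + t)) = (if t < Suc m then x (Suc t) (Suc c) else \<zero>)"
proof (cases "t < Suc m")
  case True
  then have "Suc t \<in> {1..Suc m}" by simp
  then show ?thesis
    using cbm idx_cong[of c t] idx_range[of "c + t"] assms True unfolding is_cbm_def by auto
next
  case False
  have "\<not> [int (idx (c + t)) = int (Suc c) + int s - int i] (mod int n)" if s: "s \<in> {1..Suc m}" for s
  proof
    assume "[int (idx (c + t)) = int (Suc c) + int s - int i] (mod int n)"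
    then have "[int (Suc c) + int (Suc t) - int i = int (Suc c) + int s - int i] (mod int n)"
      using idx_cong[of c t] by (metis cong_sym cong_trans)
    moreover obtain s' where s': "s = Suc s'" "s' < Suc m" using s by (cases s) auto
    ultimately have "[int t = int s'] (mod int n)"
      by (simp add: cong_iff_dvd_diff)
    then have "t = s'"
      using s' assms m_less by (intro cong_less_modulus_unique_nat[of _ _ n]) (auto simp: cong_int_iff)
    then show False using s' False by simp
  qed
  then show ?thesis
    using cbm idx_range[of "c + t"] assms False unfolding is_cbm_def by auto
qed

lemma M_closed: "r \<in> {1..n} \<Longrightarrow> l \<in> {1..n} \<Longrightarrow> M r l \<in> carrier F"
proof -
  assume "r \<in> {1..n}" "l \<in> {1..n}"
  then obtain c where c: "r = Suc c" "c < n" by (cases r) auto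
  from \<open>l \<in> {1..n}\<close> obtain t where t: "l = idx (c + t)" "t < n"
    unfolding idx_image[of c, symmetric] by blast
  show ?thesis using M_band[OF c(2) t(2)] c t x_closed by simp
qed

text \<open>The sum is reordered cyclically so that it starts at the first band entry of the row;
  beyond the band its terms vanish.\<close>

lemma band_product:
  assumes c: "c < n" and u: "\<And>l. l \<in> {1..n} \<Longrightarrow> u l \<in> carrier F"
  shows "(\<Oplus>l\<in>{1..n}. M (Suc c) l \<otimes> u l) = (\<Oplus>t\<in>{..<Suc m}. x (Suc t) (Suc c) \<otimes> u (idx (c + t)))"
proof -
  have cl: "M (Suc c) l \<otimes> u l \<in> carrier F" if "l \<in> {1..n}" for l
    using that c u M_closed[of "Suc c" l] by simp
  have "(\<Oplus>l\<in>{1..n}. M (Suc c) l \<otimes> u l) = (\<Oplus>t\<in>{..<n}. M (Suc c) (idx (c + t)) \<otimes> u (idx (c + t)))"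
    using cl by (subst idx_image[of c, symmetric], subst finsum_reindex[OF _ idx_inj]) (use cl[OF idx_range] in auto)
  also have "\<dots> = (\<Oplus>t\<in>{..<Suc m}. x (Suc t) (Suc c) \<otimes> u (idx (c + t)))"
  proof (rule add.finprod_mono_neutral_cong_right)
    show "{..<Suc m} \<subseteq> {..<n}" using m_less by auto
    show "M (Suc c) (idx (c + t)) \<otimes> u (idx (c + t)) = \<zero>" if "t \<in> {..<n} - {..<Suc m}" for t
      using that M_band[OF c, of t] u[OF idx_range] by simp
    show "M (Suc c) (idx (c + t)) \<otimes> u (idx (c + t)) = x (Suc t) (Suc c) \<otimes> u (idx (c + t))"
      if "t \<in> {..<Suc m}" for t
      using that M_band[OF c, of t] m_less by simp
    show "(\<lambda>t. M (Suc c) (idx (c + t)) \<otimes> u (idx (c + t))) \<in> {..<n} \<rightarrow> carrier F"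
      using cl idx_range by blast
  qed simp
  finally show ?thesis .
qed

text \<open>Because \<open>N\<close> is a left inverse of \<open>M\<close>, the vector
  \<open>u\<close> equals \<open>N\<close> applied to \<open>M u\<close>.\<close>

lemma mult_eq_zeroD:
  assumes u: "\<And>l. l \<in> {1..n} \<Longrightarrow> u l \<in> carrier F"
    and Mu: "\<And>r. r \<in> {1..n} \<Longrightarrow> (\<Oplus>l\<in>{1..n}. M r l \<otimes> u l) = \<zero>" and r: "r \<in> {1..n}"
  shows "u r = \<zero>"
proof -
  have N: "N r l \<in> carrier F" if "l \<in> {1..n}" for l
    using inverse r that by (auto simp: inverse_matrix_def)
  have NM: "(\<Oplus>p\<in>{1..n}. N r p \<otimes> M p l) = (if r = l then \<one> else \<zero>)" if "l \<in> {1..n}" for l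
    using inverse r that unfolding inverse_matrix_def by blast
  have "u r = (\<Oplus>l\<in>{1..n}. if r = l then u l else \<zero>)"
    using r u by (subst finsum_singleton) auto
  also have "\<dots> = (\<Oplus>l\<in>{1..n}. (\<Oplus>p\<in>{1..n}. N r p \<otimes> M p l) \<otimes> u l)"
    using u NM by (intro finsum_cong') auto
  also have "\<dots> = (\<Oplus>l\<in>{1..n}. \<Oplus>p\<in>{1..n}. N r p \<otimes> (M p l \<otimes> u l))"
  proof (intro finsum_cong' refl)
    fix l assume l: "l \<in> {1..n}"
    have "(\<Oplus>p\<in>{1..n}. N r p \<otimes> M p l) \<otimes> u l = (\<Oplus>p\<in>{1..n}. N r p \<otimes> M p l \<otimes> u l)"
      using l u N M_closed by (intro finsum_ldistr) auto
    also have "\<dots> = (\<Oplus>p\<in>{1..n}. N r p \<otimes> (M p l \<otimes> u l))"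
      using l u N M_closed by (intro finsum_cong') (auto simp: m_assoc)
    finally show "(\<Oplus>p\<in>{1..n}. N r p \<otimes> M p l) \<otimes> u l = (\<Oplus>p\<in>{1..n}. N r p \<otimes> (M p l \<otimes> u l))" .
  qed (use u N M_closed in \<open>auto intro!: finsum_closed\<close>)
  also have "\<dots> = (\<Oplus>p\<in>{1..n}. \<Oplus>l\<in>{1..n}. N r p \<otimes> (M p l \<otimes> u l))"
    using u N M_closed by (intro finsum_swap) auto
  also have "\<dots> = \<zero>"
  proof (rule add.finprod_one_eqI)
    fix p assume p: "p \<in> {1..n}"
    have "(\<Oplus>l\<in>{1..n}. N r p \<otimes> (M p l \<otimes> u l)) = N r p \<otimes> (\<Oplus>l\<in>{1..n}. M p l \<otimes> u l)"
      using p u N M_closed by (intro finsum_rdistr[symmetric]) auto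
    then show "(\<Oplus>l\<in>{1..n}. N r p \<otimes> (M p l \<otimes> u l)) = \<zero>" using Mu[OF p] N[OF p] by simp
  qed
  finally show ?thesis .
qed

section \<open>The normalized equations and their solutions\<close>

definition al :: "nat \<Rightarrow> nat \<Rightarrow> 'a" where
  "al c t = x (Suc t) (Suc c) \<otimes> inv (x (Suc m) (Suc c))"

definition be :: "nat \<Rightarrow> 'a" where
  "be c = \<ominus> \<one> \<otimes> inv (x (Suc m) (Suc c))"

text \<open>The last coefficient is invertible, so dividing by it loses nothing. \<open>L\<close>
  and \<open>B\<close> are prescribed only on valid indices because they will be arrays of a program
  state.\<close>

lemma solves_iff:
  assumes L: "\<And>c t. c < n \<Longrightarrow> t < m \<Longrightarrow> L c t = al c t" and B: "\<And>c. c < n \<Longrightarrow> B c = be c"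
    and z: "\<And>l. z l \<in> carrier F" and b: "\<And>c. b c \<in> carrier F"
  shows "solves n m L B z b \<longleftrightarrow> (\<forall>c<n. (\<Oplus>t\<in>{..<Suc m}. x (Suc t) (Suc c) \<otimes> z (c + t)) = b c)"
proof -
  have "z (c + m) = \<ominus> ((\<Oplus>t\<in>{..<m}. L c t \<otimes> z (c + t)) \<oplus> B c \<otimes> b c) \<longleftrightarrow>
      (\<Oplus>t\<in>{..<Suc m}. x (Suc t) (Suc c) \<otimes> z (c + t)) = b c" if c: "c < n" for c
  proof -
    define w where "w = x (Suc m) (Suc c)"
    have w: "w \<in> carrier F" "w \<noteq> \<zero>" using c x_closed x_nonzero by (auto simp: w_def)
    then have iw: "inv w \<in> carrier F" "w \<otimes> inv w = \<one>" using field_Units by auto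
    define S where "S = (\<Oplus>t\<in>{..<m}. x (Suc t) (Suc c) \<otimes> z (c + t))"
    have S: "S \<in> carrier F"
      unfolding S_def using c x_closed z by (intro finsum_closed) auto
    have "L c t \<otimes> z (c + t) = inv w \<otimes> (x (Suc t) (Suc c) \<otimes> z (c + t))" if t: "t < m" for t
    proof -
      have "x (Suc t) (Suc c) \<in> carrier F" using t c by (intro x_closed) auto
      then show ?thesis using L[OF c t] iw(1) z[of "c + t"] by (simp add: al_def w_def[symmetric] m_ac)
    qed
    then have "(\<Oplus>t\<in>{..<m}. L c t \<otimes> z (c + t)) = (\<Oplus>t\<in>{..<m}. inv w \<otimes> (x (Suc t) (Suc c) \<otimes> z (c + t)))"
      using c x_closed z iw(1) by (intro finsum_cong') auto
    also have "\<dots> = inv w \<otimes> S"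
      unfolding S_def using c x_closed z iw by (intro finsum_rdistr[symmetric]) auto
    finally have LS: "(\<Oplus>t\<in>{..<m}. L c t \<otimes> z (c + t)) = inv w \<otimes> S" .
    have xS: "(\<Oplus>t\<in>{..<Suc m}. x (Suc t) (Suc c) \<otimes> z (c + t)) = S \<oplus> w \<otimes> z (c + m)"
    proof -
      have "(\<Oplus>t\<in>insert m {..<m}. x (Suc t) (Suc c) \<otimes> z (c + t)) = x (Suc m) (Suc c) \<otimes> z (c + m) \<oplus> S"
        unfolding S_def using c x_closed z by (intro finsum_insert) auto
      then show ?thesis using S w z by (simp add: lessThan_Suc w_def a_comm)
    qed
    have "\<ominus> (inv w \<otimes> S \<oplus> B c \<otimes> b c) = inv w \<otimes> (b c \<ominus> S)"
      using B[OF c] iw(1) S b[of c]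
      by (simp add: be_def w_def[symmetric] l_minus minus_add a_minus_def r_distr r_minus a_comm)
    then have "z (c + m) = \<ominus> (inv w \<otimes> S \<oplus> B c \<otimes> b c) \<longleftrightarrow> z (c + m) = inv w \<otimes> (b c \<ominus> S)" by simp
    also have "\<dots> \<longleftrightarrow> w \<otimes> z (c + m) = b c \<ominus> S"
    proof
      assume "z (c + m) = inv w \<otimes> (b c \<ominus> S)"
      then have "w \<otimes> z (c + m) = (w \<otimes> inv w) \<otimes> (b c \<ominus> S)"
        using w(1) iw(1) S b[of c] by (simp add: m_assoc)
      then show "w \<otimes> z (c + m) = b c \<ominus> S" using iw(2) S b[of c] by simp
    next
      assume *: "w \<otimes> z (c + m) = b c \<ominus> S"
      have "inv w \<otimes> (w \<otimes> z (c + m)) = (w \<otimes> inv w) \<otimes> z (c + m)"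
        using w(1) iw(1) z[of "c + m"] by (simp add: m_ac)
      then show "z (c + m) = inv w \<otimes> (b c \<ominus> S)" using * iw(2) z[of "c + m"] by simp
    qed
    also have "\<dots> \<longleftrightarrow> S \<oplus> w \<otimes> z (c + m) = b c"
      using S w(1) b[of c] z[of "c + m"] by (intro eq_minus_iff) simp_all
    finally show ?thesis unfolding LS xS .
  qed
  then show ?thesis unfolding solves_def using z b by blast
qed

text \<open>Equation \<open>J\<close> defines the value at \<open>J + m\<close> from earlier values,
  and this position occurs in none of the equations before it; so the initial values extend step by
  step.\<close>

lemma solves_exists:
  assumes L: "\<And>c t. L c t \<in> carrier F" and v: "\<And>l. v l \<in> carrier F" and B: "\<And>c. B c \<in> carrier F"
  shows "\<exists>z. solves n m L B z (\<lambda>_. \<zero>) \<and> (\<forall>t<m. z t = v t)"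
proof -
  have "\<exists>z. solves J m L B z (\<lambda>_. \<zero>) \<and> (\<forall>t<m. z t = v t)" for J
  proof (induction J)
    case 0
    show ?case using v by (intro exI[of _ v]) (simp add: solves_def)
  next
    case (Suc J)
    then obtain z where z: "solves J m L B z (\<lambda>_. \<zero>)" "\<forall>t<m. z t = v t" by blast
    have zc: "z l \<in> carrier F" for l using z by (simp add: solves_def)
    define z' where "z' = z(J + m := \<ominus> (\<Oplus>t\<in>{..<m}. L J t \<otimes> z (J + t)))"
    have z'c: "z' l \<in> carrier F" for l
      using zc L by (auto simp: z'_def intro!: finsum_closed a_inv_closed)
    have sum: "(\<Oplus>t\<in>{..<m}. L c t \<otimes> z' (c + t)) = (\<Oplus>t\<in>{..<m}. L c t \<otimes> z (c + t))" if "c \<le> J" for c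
      using that zc L by (intro finsum_cong') (auto simp: z'_def)
    have "z' (c + m) = \<ominus> ((\<Oplus>t\<in>{..<m}. L c t \<otimes> z' (c + t)) \<oplus> B c \<otimes> \<zero>)" if "c < Suc J" for c
    proof -
      have cl: "(\<Oplus>t\<in>{..<m}. L c t \<otimes> z (c + t)) \<in> carrier F" using zc L by (intro finsum_closed) auto
      have "c \<le> J" using that by simp
      moreover have "z' (c + m) = \<ominus> (\<Oplus>t\<in>{..<m}. L c t \<otimes> z (c + t))"
        using that z(1) cl B by (cases "c = J") (auto simp: z'_def solves_def)
      moreover have "B c \<otimes> \<zero> = \<zero>" using B by simp
      ultimately show ?thesis using cl by (simp only: sum r_zero)
    qed
    moreover have "\<forall>t<m. z' t = v t" using z(2) by (simp add: z'_def)
    ultimately show ?case using z'c by (intro exI[of _ z']) (simp add: solves_def)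
  qed
  then show ?thesis .
qed

text \<open>This is where invertibility of the matrix makes the small system nonsingular: a kernel
  vector extends by the recurrence to a periodic homogeneous solution, which has to vanish.\<close>

lemma trivial_kernel_rows:
  assumes L: "\<And>c t. c < n \<Longrightarrow> t < m \<Longrightarrow> L c t = al c t" and B: "\<And>c. c < n \<Longrightarrow> B c = be c"
    and Lc: "\<And>c t. L c t \<in> carrier F" and Bc: "\<And>c. B c \<in> carrier F" and A: "\<And>q l. A q l \<in> carrier F"
    and inv: "\<And>q. q < m \<Longrightarrow> row_inv n m L B q 0 (A q)"
  shows "trivial_kernel (n + m + n) m A"
  unfolding trivial_kernel_def
proof (intro ballI impI)
  fix y assume y: "y \<in> kern (n + m + n) m A" and y0: "\<forall>l. m \<le> l \<longrightarrow> y l = \<zero>"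
  have yc: "y l \<in> carrier F" for l using y by (simp add: kern_def)
  obtain z where z: "solves n m L B z (\<lambda>_. \<zero>)" and zy: "\<forall>t<m. z t = y t"
    using solves_exists[of L y B, OF Lc yc Bc] by blast
  have zc: "z l \<in> carrier F" for l using z by (simp add: solves_def)
  \<comment> \<open>With boundary 0 and zero right-hand sides, row \<open>q\<close> of the kernel
    condition is exactly this periodicity condition.\<close>
  have wrap: "z (n + q) = z q" if q: "q < m" for q
  proof -
    have "(\<Oplus>l\<in>{..<n + m + n}. A q l \<otimes> y l) = \<zero>" using y q by (simp add: kern_def)
    moreover have "(\<Oplus>l\<in>{..<n + m + n}. A q l \<otimes> y l) = (\<Oplus>l\<in>{..<m}. A q l \<otimes> y l)"
      using A yc y0 by (intro add.finprod_mono_neutral_cong_right) auto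
    moreover have "(\<Oplus>l\<in>{..<m}. A q l \<otimes> y l) = (\<Oplus>l\<in>{..<m}. A q l \<otimes> z l)"
      using A zc zy by (intro lsum_cong) auto
    ultimately have "(\<Oplus>l\<in>{..<m}. A q l \<otimes> z l) = \<zero>" by simp
    moreover have "(\<Oplus>c\<in>{0..<n}. A q (n + m + c) \<otimes> \<zero>) = \<zero>"
      using A by (intro add.finprod_one_eqI) simp
    ultimately have "z q \<ominus> z (n + q) = \<zero>"
      using inv[OF q, unfolded row_inv_def, rule_format, OF z] by (simp add: a_minus_def)
    then show ?thesis using zc by simp
  qed
  define u where "u l = z (the_inv_into {..<n} idx l)" for l
  have inj: "inj_on idx {..<n}" using idx_inj[of 0] by simp
  have u1: "u (idx j) = z j" if "j < n" for j
    unfolding u_def using the_inv_into_f_f[OF inj] that by simp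
  \<comment> \<open>The last \<open>m\<close> equations reach beyond index \<open>n - 1\<close>;
    there \<open>wrap\<close> identifies the extended values with those of the vector on the
    columns.\<close>
  have u: "u (idx j) = z j" if "j < n + m" for j
  proof (cases "j < n")
    case False
    define q where "q = j - n"
    have q: "j = n + q" "q < m" using False that by (simp_all add: q_def)
    then show ?thesis using u1[of q] m_less wrap[of q] by (simp add: idx_periodic)
  qed (rule u1)
  have uz: "u l = \<zero>" if "l \<in> {1..n}" for l
  proof (rule mult_eq_zeroD[OF _ _ that])
    show "u l \<in> carrier F" for l by (simp add: u_def zc)
    fix r assume "r \<in> {1..n}"
    then obtain c where c: "r = Suc c" "c < n" by (cases r) auto
    have "(\<Oplus>l\<in>{1..n}. M r l \<otimes> u l) = (\<Oplus>t\<in>{..<Suc m}. x (Suc t) (Suc c) \<otimes> u (idx (c + t)))"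
      unfolding c(1) by (rule band_product[OF c(2)]) (simp add: u_def zc)
    also have "\<dots> = (\<Oplus>t\<in>{..<Suc m}. x (Suc t) (Suc c) \<otimes> z (c + t))"
      using c x_closed zc u by (intro finsum_cong') auto
    also have "\<dots> = \<zero>"
      using z c solves_iff[of L B z "\<lambda>_. \<zero>", OF L B zc zero_closed] by blast
    finally show "(\<Oplus>l\<in>{1..n}. M r l \<otimes> u l) = \<zero>" .
  qed
  show "\<forall>l. y l = \<zero>"
  proof
    fix l
    show "y l = \<zero>"
    proof (cases "l < m")
      case True
      then show ?thesis using zy u1[of l] uz[OF idx_range[of l]] m_less by simp
    qed (use y0 in simp)
  qed
qed

lemma inverse_column_solves:
  assumes L: "\<And>c t. c < n \<Longrightarrow> t < m \<Longrightarrow> L c t = al c t" and B: "\<And>c. c < n \<Longrightarrow> B c = be c"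
    and c: "c < n"
  shows "solves n m L B (\<lambda>j. N (idx j) (Suc c)) (\<lambda>c'. if c' = c then \<one> else \<zero>)"
proof -
  have N: "N l (Suc c) \<in> carrier F" if "l \<in> {1..n}" for l
    using inverse c that unfolding inverse_matrix_def by force
  have "(\<Oplus>t\<in>{..<Suc m}. x (Suc t) (Suc c') \<otimes> N (idx (c' + t)) (Suc c)) = (if c' = c then \<one> else \<zero>)"
    if "c' < n" for c'
  proof -
    have "Suc c' \<in> {1..n}" "Suc c \<in> {1..n}" using that c by auto
    then have "(\<Oplus>l\<in>{1..n}. M (Suc c') l \<otimes> N l (Suc c)) = (if Suc c' = Suc c then \<one> else \<zero>)"
      using inverse unfolding inverse_matrix_def by blast
    then show ?thesis using band_product[OF that, of "\<lambda>l. N l (Suc c)"] N by simp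
  qed
  then show ?thesis
    using N idx_range by (subst solves_iff[OF L B]) auto
qed

text \<open>The entry -1 selects one right-hand-side column, and the zeros at the positions from
  \<open>m\<close> up to \<open>n + m\<close> blind out the garbage left by the elimination.\<close>

lemma kern_column:
  fixes f z :: "nat \<Rightarrow> 'a" and c :: nat
  assumes f: "\<And>l. f l \<in> carrier F" and z: "\<And>l. z l \<in> carrier F" and c: "c < n"
  shows "(\<Oplus>l\<in>{..<n + m + n}. f l \<otimes> (if l < m then z l else if l = n + m + c then \<ominus> \<one> else \<zero>)) =
    (\<Oplus>l\<in>{..<m}. f l \<otimes> z l) \<ominus> f (n + m + c)" (is "(\<Oplus>l\<in>_. f l \<otimes> ?y l) = _")
proof -
  have y: "?y l \<in> carrier F" for l using z by simp
  have "(\<Oplus>l\<in>{..<m + (n + n)}. f l \<otimes> ?y l) =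
      (\<Oplus>l\<in>{..<m}. f l \<otimes> ?y l) \<oplus> (\<Oplus>t\<in>{..<n + n}. f (m + t) \<otimes> ?y (m + t))"
    using f y by (intro lsum_split) blast
  also have "(\<Oplus>l\<in>{..<m}. f l \<otimes> ?y l) = (\<Oplus>l\<in>{..<m}. f l \<otimes> z l)"
    using f z by (intro lsum_cong) auto
  also have "(\<Oplus>t\<in>{..<n + n}. f (m + t) \<otimes> ?y (m + t)) = f (m + (n + c)) \<otimes> ?y (m + (n + c))"
    using f z c by (intro lsum_single) auto
  also have "\<dots> = \<ominus> f (n + m + c)"
    using f by (simp add: r_minus ac_simps)
  finally show ?thesis by (simp add: a_minus_def ac_simps)
qed

text \<open>A column of \<open>N\<close> in cyclic order is periodic, so with the entry -1 it gives
  a kernel vector of the rows before Gauss-Jordan elimination, hence also afterwards. With the unit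
  block in front, row \<open>q\<close> then equates the recorded entry with
  \<open>z q\<close>.\<close>

lemma reduced_columns:
  assumes L: "\<And>c t. c < n \<Longrightarrow> t < m \<Longrightarrow> L c t = al c t" and B: "\<And>c. c < n \<Longrightarrow> B c = be c"
    and A: "\<And>q l. A q l \<in> carrier F" and A': "\<And>q l. A' q l \<in> carrier F"
    and inv: "\<And>q. q < m \<Longrightarrow> row_inv n m L B q 0 (A q)"
    and kern: "kern (n + m + n) m A' = kern (n + m + n) m A"
    and unit: "\<And>r l. r < m \<Longrightarrow> l < m \<Longrightarrow> A' r l = (if r = l then \<one> else \<zero>)"
    and c: "c < n" and q: "q < m"
  shows "A' q (n + m + c) = N (idx q) (Suc c)"
proof -
  define z where "z j = N (idx j) (Suc c)" for j
  note sol = inverse_column_solves[OF L B c, folded z_def]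
  then have z: "z l \<in> carrier F" for l by (simp add: solves_def)
  define y where "y l = (if l < m then z l else if l = n + m + c then \<ominus> \<one> else \<zero>)" for l
  have "y \<in> kern (n + m + n) m A"
  proof -
    have "(\<Oplus>l\<in>{..<n + m + n}. A p l \<otimes> y l) = \<zero>" if p: "p < m" for p
    proof -
      have "(\<Oplus>c'\<in>{0..<n}. A p (n + m + c') \<otimes> (if c' = c then \<one> else \<zero>)) =
          (\<Oplus>c'\<in>{0..<n}. if c = c' then A p (n + m + c') else \<zero>)"
        using A by (intro finsum_cong') auto
      also have "\<dots> = A p (n + m + c)" using A c by (intro finsum_singleton) auto
      finally have "z p \<ominus> z (n + p) = (\<Oplus>l\<in>{..<m}. A p l \<otimes> z l) \<ominus> A p (n + m + c)"
        using inv[OF p, unfolded row_inv_def, rule_format, OF sol] by simp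
      moreover have "z (n + p) = z p" by (simp add: z_def idx_periodic)
      ultimately show ?thesis
        unfolding y_def using kern_column[of "A p" z c] A z c by (simp add: a_minus_def r_neg)
    qed
    then show ?thesis using z by (simp add: kern_def y_def)
  qed
  then have "(\<Oplus>l\<in>{..<n + m + n}. A' q l \<otimes> y l) = \<zero>"
    unfolding kern[symmetric] using q by (simp add: kern_def)
  then have "(\<Oplus>l\<in>{..<m}. A' q l \<otimes> z l) \<ominus> A' q (n + m + c) = \<zero>"
    unfolding y_def using kern_column[of "A' q" z c] A' z c by simp
  moreover have "(\<Oplus>l\<in>{..<m}. A' q l \<otimes> z l) = A' q q \<otimes> z q"
    using q unit A' z by (intro lsum_single) auto
  ultimately have "z q \<ominus> A' q (n + m + c) = \<zero>" using unit[OF q q] z by simp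
  then show ?thesis using z A' by (simp add: z_def)
qed

end

text \<open>The summands belong to normalization, elimination, Gauss-Jordan and the recurrence. With
  \<open>k = Suc m\<close>, the first two add up to \<open>k ^ 2 * n\<close>, the third is at most
  three times that because a row has at most \<open>3 * n\<close> entries, and the last is at most
  \<open>k * n ^ 2\<close>.\<close>

lemma cost_bound:
  fixes n m :: nat
  assumes "m < n"
  shows "real (n * (m + 1) + m * (n * (m + 1)) + m * ((n + m + n) + m * (n + m + n)) + n * (n * m))
    \<le> 5 * (real (Suc m) ^ 3 * real n + real (Suc m) ^ 5) + real (Suc m) * real n ^ 2"
proof -
  define k where "k = Suc m"
  have "n * (m + 1) + m * (n * (m + 1)) = k ^ 2 * n"
    by (simp add: k_def power2_eq_square algebra_simps)
  moreover have "m * ((n + m + n) + m * (n + m + n)) \<le> 3 * (k ^ 2 * n)"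
  proof -
    have "m * ((n + m + n) + m * (n + m + n)) = m * (k * (n + m + n))"
      by (simp add: k_def algebra_simps)
    also have "\<dots> \<le> k * (k * (3 * n))"
      using assms by (intro mult_mono) (auto simp: k_def)
    finally show ?thesis by (simp add: power2_eq_square ac_simps)
  qed
  moreover have "n * (n * m) \<le> k * n ^ 2" by (simp add: k_def power2_eq_square)
  ultimately have "n * (m + 1) + m * (n * (m + 1)) + m * ((n + m + n) + m * (n + m + n)) + n * (n * m)
      \<le> 4 * (k ^ 2 * n) + k * n ^ 2"
    by linarith
  also have "\<dots> \<le> 5 * (k ^ 3 * n + k ^ 5) + k * n ^ 2"
  proof -
    have "k ^ 2 * n \<le> k ^ 3 * n" by (intro mult_right_mono power_increasing) (auto simp: k_def)
    then have "4 * (k ^ 2 * n) \<le> 5 * (k ^ 3 * n)" by (rule mult_le_mono[rotated]) simp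
    also have "\<dots> \<le> 5 * (k ^ 3 * n + k ^ 5)" by simp
    finally show ?thesis by simp
  qed
  finally have "real (n * (m + 1) + m * (n * (m + 1)) + m * ((n + m + n) + m * (n + m + n)) + n * (n * m))
      \<le> real (5 * (k ^ 3 * n + k ^ 5) + k * n ^ 2)"
    by (rule of_nat_mono)
  then show ?thesis by (simp only: k_def of_nat_add of_nat_mult of_nat_power of_nat_numeral)
qed

text \<open>The specifications of the four phases are chained. The inverse \<open>N\<close> enters
  through \<open>trivial_kernel_rows\<close>, which guarantees the pivots, and through
  \<open>reduced_columns\<close>, which identifies the computed initial values.\<close>

lemma (in cbm) cbm_prog_correct:
  "\<exists>st. exec F cbm_prog (cbm_input F n (Suc m) i x) = Some st \<and> inverse_matrix F n M (arr st ''inv'')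
     \<and> cost st \<le> n * (m + 1) + m * (n * (m + 1)) + m * ((n + m + n) + m * (n + m + n)) + n * (n * m)"
proof -
  define T where "T = n * (m + 1) + m * (n * (m + 1)) + m * ((n + m + n) + m * (n + m + n)) + n * (n * m)"
  define s0 where "s0 = cbm_input F n (Suc m) i x"
  define s1 where "s1 = fput (Loc ''U'' (Num 0) (Num 0)) (\<ominus> \<one>) (fput (Loc ''U'' (Num 0) (Num 0)) \<one> (iput ''m'' m s0))"
  have cl0: "closed_state F s0"
    using cbm by (auto simp: s0_def closed_state_def cbm_input_def is_cbm_def)
  have cl1: "closed_state F s1"
    unfolding s1_def using cl0 by (intro closed_fput) simp_all
  have s1: "ivar s1 ''n'' = n" "ivar s1 ''m'' = m" "ivar s1 ''k'' = Suc m" "ivar s1 ''i'' = i"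
    "arr s1 ''U'' 0 0 = \<ominus> \<one>" "arr s1 ''O'' 0 0 = \<zero>" "\<And>q l. arr s1 ''A'' q l = \<zero>" "cost s1 = 0"
    by (simp_all add: s1_def s0_def cbm_input_def)
  have x1: "arr s1 ''x'' (Suc t) (Suc c) = x (Suc t) (Suc c)" if "t < Suc m" "c < n" for t c
    using that by (simp add: s1_def s0_def cbm_input_def)
  have "wp F (Seq norm_prog (Seq elim_prog (Seq gauss_prog solve_prog)))
      (\<lambda>s. inverse_matrix F n M (arr s ''inv'') \<and> cost s \<le> T) s1"
    unfolding wp_simps(2)
  proof (rule wp_mono[OF field_axioms cl1 wp_norm_prog[OF cl1 s1(1-3)]], goal_cases)
    case (1 c)
    then show ?case using x1[of m c] x_nonzero by simp
  next
    case (2 s2)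
    note cl2 = 2(3)
    have s2: "ivar s2 ''n'' = n" "ivar s2 ''m'' = m" "ivar s2 ''i'' = i"
      "arr s2 ''U'' 0 0 = \<ominus> \<one>" "arr s2 ''O'' 0 0 = \<zero>" "\<And>q l. arr s2 ''A'' q l = \<zero>"
      "cost s2 \<le> n * (m + 1)"
      using 2 s1 by (simp_all add: unchanged_def norm_prog_def)
    have L: "arr s2 ''L'' c t = al c t" if "c < n" "t < m" for c t
      using 2(1) that x1 by (simp add: al_def)
    have B: "arr s2 ''B'' c 0 = be c" if "c < n" for c
      using 2(1) that x1[of m c] s1(5) by (simp add: be_def)
    show ?case
    proof (rule wp_mono[OF field_axioms cl2 wp_elim_prog[OF cl2 s2(1,2) m_less s2(4-6)]], goal_cases)
      case (1 s3)
      note cl3 = 1(3)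
      have s3: "ivar s3 ''n'' = n" "ivar s3 ''m'' = m" "ivar s3 ''i'' = i" "arr s3 ''O'' 0 0 = \<zero>"
        "arr s3 ''L'' = arr s2 ''L''" "arr s3 ''B'' = arr s2 ''B''"
        using 1(2) s2 by (simp_all add: unchanged_def elim_prog_def elim_row_def elim_step_def)
      have inv: "row_inv n m (arr s2 ''L'') (\<lambda>c. arr s2 ''B'' c 0) q 0 (arr s3 ''A'' q)" if "q < m" for q
        using 1(1) that by blast
      have cost3: "cost s3 \<le> n * (m + 1) + m * (n * (m + 1))" using 1(1) s2(7) by linarith
      have "trivial_kernel (n + m + n) m (arr s3 ''A'')"
        by (rule trivial_kernel_rows[OF L B _ _ _ inv]) (simp_all add: closed_stateD[OF cl2] closed_stateD[OF cl3])
      then show ?case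
      proof (rule wp_mono[OF field_axioms cl3 wp_gauss_prog[OF cl3 s3(1,2,4)]], goal_cases)
        case (1 s4)
        note cl4 = 1(3)
        have s4: "ivar s4 ''n'' = n" "ivar s4 ''m'' = m" "ivar s4 ''i'' = i" "arr s4 ''O'' 0 0 = \<zero>"
          "arr s4 ''L'' = arr s2 ''L''" "arr s4 ''B'' = arr s2 ''B''"
          using 1(2) s3
          by (simp_all add: unchanged_def gauss_prog_def pivot_prog_def scale_prog_def reduce_prog_def subtract_row_def)
        have kern: "kern (n + m + n) m (arr s4 ''A'') = kern (n + m + n) m (arr s3 ''A'')"
          and unit: "\<And>r l. r < m \<Longrightarrow> l < m \<Longrightarrow> arr s4 ''A'' r l = (if r = l then \<one> else \<zero>)"
          and cost4: "cost s4 \<le> n * (m + 1) + m * (n * (m + 1)) + m * ((n + m + n) + m * (n + m + n))"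
          using 1(1) cost3 by (blast, blast, linarith)
        have cols: "arr s4 ''A'' j (n + m + c) = N (idx j) (Suc c)" if "c < n" "j < m" for c j
          by (rule reduced_columns[OF L B _ _ inv kern unit that])
            (simp_all add: closed_stateD[OF cl3] closed_stateD[OF cl4])
        show ?case
        proof (rule wp_mono[OF field_axioms cl4 wp_solve_prog[OF cl4 s4(1-4) cols, where N = N]], goal_cases)
          case (3 c)
          then show ?case unfolding s4 by (intro inverse_column_solves[OF L B])
        next
          case (5 s5)
          \<comment> \<open>The specification speaks of the rows \<open>idx j\<close> with
            \<open>j < n\<close>, and these are all rows.\<close>
          have "arr s5 ''inv'' r c = N r c" if "r \<in> {1..n}" "c \<in> {1..n}" for r c
          proof -
            from \<open>r \<in> {1..n}\<close> obtain j where "r = idx j" "j < n"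
              using idx_image[of 0] by (metis (no_types, lifting) add_0 imageE lessThan_iff)
            moreover obtain c' where "c = Suc c'" "c' < n" using \<open>c \<in> {1..n}\<close> by (cases c) auto
            ultimately show ?thesis using 5(1) unfolding idx_def by blast
          qed
          moreover have "N r c \<in> carrier F" if "r \<in> {1..n}" "c \<in> {1..n}" for r c
            using inverse that by (auto simp: inverse_matrix_def)
          ultimately have "inverse_matrix F n M (arr s5 ''inv'') = inverse_matrix F n M N"
            by (intro inverse_matrix_cong[OF ring_axioms]) (auto simp: M_closed)
          moreover have "cost s5 \<le> T" using 5(1) cost4 by (simp add: T_def)
          ultimately show ?case using inverse by simp
        qed (simp_all add: idx_def)
      qed
    qed
  qed
  then have "wp F cbm_prog (\<lambda>s. inverse_matrix F n M (arr s ''inv'') \<and> cost s \<le> T) s0"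
    by (simp add: cbm_prog_def s1_def s0_def cbm_input_def a_minus_def del: fput.simps)
  then show ?thesis unfolding wp_def s0_def T_def by blast
qed

lemma inverts_cbms_cbm_prog: "inverts_cbms TYPE('a) cbm_prog 5"
  unfolding inverts_cbms_def
proof (intro allI impI, elim conjE)
  fix F :: "'a ring" and n k i :: nat and x M
  assume F: "field F" and k: "2 \<le> k" "k \<le> n" and cbm: "is_cbm F n k i x M"
    and "invertible_matrix F n M"
  then obtain N where N: "inverse_matrix F n M N" by (auto simp: invertible_matrix_def)
  obtain m where m: "k = Suc m" "m < n" using k by (cases k) auto
  interpret cbm F n m i x M N
    using F N cbm m by (simp add: cbm_def ring_field_def cbm_axioms_def)
  obtain st where st: "exec F cbm_prog (cbm_input F n k i x) = Some st" "inverse_matrix F n M (arr st ''inv'')"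
    "cost st \<le> n * (m + 1) + m * (n * (m + 1)) + m * ((n + m + n) + m * (n + m + n)) + n * (n * m)"
    using cbm_prog_correct unfolding m(1) by blast
  have "real (cost st) \<le> 5 * (real k ^ 3 * real n + real k ^ 5) + real k * real n ^ 2"
    unfolding m(1) by (rule order.trans[OF of_nat_mono[OF st(3)] cost_bound[OF m(2)]])
  with st(1,2) show "\<exists>st. exec F cbm_prog (cbm_input F n k i x) = Some st \<and> inverse_matrix F n M (arr st ''inv'') \<and>
      real (cost st) \<le> 5 * (real k ^ 3 * real n + real k ^ 5) + real k * real n ^ 2"
    by blast
qed

theorem proposition4:
  "(\<exists>C > 0. \<exists>p. inverts_cbms TYPE(nat) p C) \<and>
   (\<forall>C p. inverts_cbms TYPE(nat) p C \<longrightarrow> inverts_cbms TYPE('a) p C)"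
  using inverts_cbms_cbm_prog inverts_cbms_transfer by (intro conjI exI[of _ "5::real"]) auto

end
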